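(* Let $d\ge 2$ be a real number. Every finite simple graph with $m$ edges, minimum degree at least $2$ and average degree $d$ has at most $m\gamma_d^m$ cycles.
   Context: A simple graph has no loops and no parallel edges. The average degree of a graph with $n$ vertices and $m$ edges is $2m/n$. The number of cycles of a graph is the number of its subgraphs that are cycles. Let $\rho=(4/3)^{1/4}$ and $b(k)=((k-1)!\,\rho)^{1/(k-1)}$ for integers $k\ge 2$. For a real number $d\ge 2$, let $\gamma_d=b(d)^{2/d}$ if $d$ is an integer, and $$\gamma_d=b(\lfloor d\rfloor)^{2(\lceil d\rceil-d)/d}\,b(\lceil d\rceil)^{2(d-\lfloor d\rfloor)/d}$$ otherwise. *)

theory Defs
  imports Complex_Main
begin

text \<open>A graph is a pair of a vertex set and an edge set, an edge being the set of its two ends.\<close>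

type_synonym 'a graph = "'a set \<times> 'a set set"

definition verts :: "'a graph \<Rightarrow> 'a set" where
  "verts G = fst G"

definition edges :: "'a graph \<Rightarrow> 'a set set" where
  "edges G = snd G"

definition finite_simple_graph :: "'a graph \<Rightarrow> bool" where
  "finite_simple_graph G \<longleftrightarrow>
     finite (verts G) \<and> (\<forall>e\<in>edges G. e \<subseteq> verts G \<and> card e = 2)"

definition vertex_degree :: "'a graph \<Rightarrow> 'a \<Rightarrow> nat" where
  "vertex_degree G v = card {e \<in> edges G. v \<in> e}"

text \<open>Only meaningful for finite graphs with at least one vertex, as is the average degree.\<close>

definition min_degree :: "'a graph \<Rightarrow> nat" where
  "min_degree G = Min (vertex_degree G ` verts G)"

definition average_degree :: "'a graph \<Rightarrow> real" where
  "average_degree G = 2 * real (card (edges G)) / real (card (verts G))"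

definition subgraph :: "'a graph \<Rightarrow> 'a graph \<Rightarrow> bool" where
  "subgraph H G \<longleftrightarrow>
     verts H \<subseteq> verts G \<and> edges H \<subseteq> edges G \<and> (\<forall>e\<in>edges H. e \<subseteq> verts H)"

definition is_cycle :: "'a graph \<Rightarrow> bool" where
  "is_cycle C \<longleftrightarrow>
     (\<exists>vs. distinct vs \<and> 3 \<le> length vs \<and> verts C = set vs \<and>
        edges C = {{vs ! i, vs ! (Suc i mod length vs)} | i. i < length vs})"

text \<open>Cycles are counted as subgraphs, so the choice of starting vertex and of
  direction in the definition above does not lead to multiple counting.\<close>

definition num_cycles :: "'a graph \<Rightarrow> nat" where
  "num_cycles G = card {C. subgraph C G \<and> is_cycle C}"

definition rho :: real where
  "rho = (4 / 3) powr (1 / 4)"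

text \<open>Used for \<open>k \<ge> 2\<close> only.\<close>

definition b_val :: "nat \<Rightarrow> real" where
  "b_val k = (fact (k - 1) * rho) powr (1 / real (k - 1))"

definition gamma :: "real \<Rightarrow> real" where
  "gamma d =
     (if d \<in> \<int> then b_val (nat \<lfloor>d\<rfloor>) powr (2 / d)
      else b_val (nat \<lfloor>d\<rfloor>) powr (2 * (real_of_int \<lceil>d\<rceil> - d) / d) *
           b_val (nat \<lceil>d\<rceil>) powr (2 * (d - real_of_int \<lfloor>d\<rfloor>) / d))"

end

theory Submission imports Defs begin

text \<open>
  Give a vertex of degree \<open>k \<ge> 2\<close> the weight \<open>b(k)\<close>. The heart of the matter is that an edge \<open>st\<close>
  lies on at most \<open>\<Prod>\<^sub>v b(d(v))\<close> cycles (\<open>card_cycles_through_edge_le\<close>). Summing over the edges gives the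
  factor \<open>m\<close>. Since \<open>ln b\<close> is concave on the integers from 2 on, the product is largest, for a given
  degree sum, when all degrees are \<open>\<lfloor>d\<rfloor>\<close> or \<open>\<lceil>d\<rceil>\<close>, and its value is then \<open>\<gamma>\<^sub>d\<^sup>m\<close>.

  A cycle through \<open>st\<close> is a path from \<open>s\<close> to \<open>t\<close> that avoids this edge. Paths are counted by
  deleting \<open>s\<close> and branching over the next vertex; each deletion lowers the degrees of the former
  neighbours, and this loss of weight has to pay for the number of branches. The induction hypothesis
  therefore also has a weight \<open>start k\<close> for the current end of the path, depending on the number
  \<open>k\<close> of its edges that are left. Put \<open>branch k = start k / b(k)\<close> and
  \<open>step k = ln b(k+1) - ln b(k)\<close>. When \<open>s\<close> is deleted, the weight \<open>b(j+1)\<close> of a neighbour of degree \<open>j + 1\<close>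
  is replaced by \<open>start j = branch j b(j)\<close> if the path goes there, and by \<open>b(j) = b(j+1) exp (- step j)\<close> if it
  does not. The induction step thus asks that \<open>(\<Sum>\<^sub>i branch j\<^sub>i) exp (- \<Sum>\<^sub>i step j\<^sub>i) \<le> start k\<close> for all \<open>j\<^sub>1, ..., j\<^sub>k\<close>, with equality
  when all \<open>j\<^sub>i\<close> are \<open>k\<close>. It follows from \<open>1 + x \<le> exp x\<close> once the points
  \<open>(step j, branch j)\<close> all lie below the line of slope \<open>k branch k\<close> through \<open>(step k, branch k)\<close>
  (\<open>start_branching\<close>, \<open>admissible_step\<close>). The sequence \<open>branch\<close> is defined by letting the point for
  \<open>k + 1\<close> lie on the line for \<open>k\<close>; the rest is the monotonicity of \<open>k branch k\<close>, which amounts to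
  \<open>step k - step (k+1) \<le> 1 / (k (k+1))\<close>.

  Vertices of degree 2 do not fit into this scheme. They are suppressed, so that the induction
  runs over multigraphs whose inner vertices have degree at least 3. A suppressed vertex leaves its weight
  \<open>b(2) = \<rho>\<close> to the parallel edge that it creates: a pair of vertices joined by \<open>\<mu>\<close> edges contributes
  \<open>\<rho>\<^bsup>\<mu>-1\<^esup>\<close> to the bound. A neighbour joined by \<open>\<mu>\<close> parallel edges turns out to be no worse than
  \<open>\<mu>\<close> neighbours joined by single edges (\<open>neighbour_admissible\<close>). The tightest case is a double edge to a
  vertex of degree 4; it needs \<open>b(2) b(4) \<ge> 2\<close>, which holds with equality and explains the value of
  \<open>\<rho>\<close>. It occurs in a closed chain of triangles, where each triangle doubles the number of long cycles and
  uses up one vertex of degree 2 and one of degree 4.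
\<close>

section \<open>The vertex weights\<close>

text \<open>Degrees 0 and 1 occur only in the course of the induction. A vertex of such a degree is useless for a
  path and may be discarded, which needs only a weight of at least 1.\<close>

definition wt :: "nat \<Rightarrow> real" where
  "wt k = (if k < 2 then 1 else b_val k)"

text \<open>For \<open>k \<ge> 2\<close> this is a discrete derivative of \<open>ln b\<close>.\<close>

definition step :: "nat \<Rightarrow> real" where
  "step k = ln (wt (Suc k)) - ln (wt k)"

text \<open>Minus the second difference of \<open>ln b\<close>; it is positive from \<open>k = 2\<close> on.\<close>

definition gap :: "nat \<Rightarrow> real" where
  "gap k = step k - step (Suc k)"

lemma rho_pow4: "rho ^ 4 = 4 / 3"
  unfolding rho_def by (simp add: powr_power)

lemma rho_pos: "rho > 0"
  unfolding rho_def by simp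

lemma rho_gt1: "rho > 1"
proof (rule ccontr)
  assume "\<not> rho > 1"
  then have "rho ^ 4 \<le> 1" using rho_pos by (intro power_le_one) auto
  then show False by (simp add: rho_pow4)
qed

lemma ln_rho: "ln rho = ln (4/3) / 4"
  unfolding rho_def by (simp add: ln_powr)

lemma wt_01 [simp]: "wt 0 = 1" "wt (Suc 0) = 1"
  by (simp_all add: wt_def)

lemma wt_pow: "wt (Suc (Suc n)) ^ Suc n = fact (Suc n) * rho"
proof -
  define x :: real where "x = fact (Suc n) * rho"
  have x: "x > 0" using rho_pos by (simp add: x_def)
  have "wt (Suc (Suc n)) ^ Suc n = (x powr (1 / real (Suc n))) ^ Suc n"
    by (simp add: wt_def b_val_def x_def del: fact_Suc of_nat_Suc power_Suc)
  also have "\<dots> = (x powr (1 / real (Suc n))) powr real (Suc n)"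
    using x by (subst powr_realpow) auto
  also have "\<dots> = x" using x by (simp add: powr_powr del: of_nat_Suc)
  finally show ?thesis by (simp add: x_def)
qed

lemma wt_ge1: "wt k \<ge> 1"
proof (cases "k < 2")
  case True then show ?thesis by (simp add: wt_def)
next
  case False
  have "(fact (k - 1) :: real) * rho \<ge> 1 * 1"
    using rho_gt1 by (intro mult_mono) auto
  then show ?thesis using False by (simp add: wt_def b_val_def ge_one_powr_ge_zero)
qed

lemma wt_pos [simp]: "wt k > 0"
  using wt_ge1[of k] by linarith

lemma wt_neq_0 [simp]: "wt k \<noteq> 0"
  using wt_ge1[of k] by auto

lemma wt_2: "wt 2 = rho"
  using wt_pow[of 0] by (simp add: numeral_2_eq_2)

lemma ln_wt: "k \<ge> 2 \<Longrightarrow> (real k - 1) * ln (wt k) = ln (fact (k - 1)) + ln rho"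
proof -
  assume "k \<ge> 2"
  then obtain n where k: "k = Suc (Suc n)" by (metis add_2_eq_Suc le_Suc_ex)
  have "ln (wt k ^ Suc n) = ln (fact (Suc n) * rho)" by (simp only: k wt_pow)
  then show ?thesis using rho_pos by (simp add: k ln_realpow ln_mult del: fact_Suc power_Suc)
qed

text \<open>Multiplying \<open>b(k)\<^bsup>k-1\<^esup> = (k-1)! \<rho>\<close> by \<open>k\<close> gives \<open>b(k+1)\<^sup>k = k b(k)\<^bsup>k-1\<^esup>\<close>, so \<open>\<rho>\<close> drops out.\<close>

lemma step_eq: "k \<ge> 2 \<Longrightarrow> real k * step k = ln (real k) - ln (wt k)"
proof -
  assume k: "k \<ge> 2"
  have "(fact k :: real) = real k * fact (k - 1)" using k by (simp add: fact_reduce)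
  then have "ln (fact k :: real) = ln (real k) + ln (fact (k - 1))"
    using k by (simp add: ln_mult)
  then show ?thesis using ln_wt[of k] ln_wt[of "Suc k"] k
    unfolding step_def by (simp add: algebra_simps)
qed

text \<open>Two consecutive instances of \<open>step_eq\<close>, with \<open>ln b\<close> eliminated. All asymptotic information on
  \<open>b\<close> is drawn from this recurrence by induction.\<close>

lemma step_rec:
  assumes "k \<ge> 2"
  shows "(real k + 1) * step (Suc k) = (real k - 1) * step k + ln (1 + 1 / real k)"
proof -
  have "1 + 1 / real k = (real k + 1) / real k" using assms by (simp add: field_simps)
  then have "ln (1 + 1 / real k) = ln (real k + 1) - ln (real k)"
    using assms by (simp add: ln_div)
  then show ?thesis
    using step_eq[of k] step_eq[of "Suc k"] assms unfolding step_def
    by (simp add: algebra_simps)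
qed

lemma ln_rho_bounds: "1/16 \<le> ln rho" "ln rho \<le> 0.07275"
proof -
  have "ln (3/4::real) \<le> 3/4 - 1" by (rule ln_le_minus_one) simp
  moreover have "ln (3/4::real) = - ln (4/3)" by (simp add: ln_div)
  ultimately show "1/16 \<le> ln rho" unfolding ln_rho by simp
  have "4/3 \<le> exp (0.291::real)"
    using exp_lower_Taylor_quadratic[of "0.291::real"] by (simp add: power2_eq_square)
  then have "ln (4/3) \<le> ln (exp (0.291::real))" by (subst ln_le_cancel_iff) auto
  then show "ln rho \<le> 0.07275" unfolding ln_rho by simp
qed

lemma step_2: "step 2 = (ln 2 - ln rho) / 2"
  using step_eq[of 2] by (simp add: wt_2)

lemma gap_eq: "k \<ge> 2 \<Longrightarrow> (real k + 1) * gap k = 2 * step k - ln (1 + 1 / real k)"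
  using step_rec[of k] unfolding gap_def by (simp add: algebra_simps)

text \<open>The smallest case is where the choice of \<open>\<rho>\<close> is visible: \<open>b(3)\<^sup>2 = \<rho> b(2) b(4)\<close>.\<close>

lemma gap_2: "gap 2 = ln rho"
proof -
  have "ln (3/2 :: real) + ln (4/3) = ln 2" using ln_mult[of "3/2::real" "4/3"] by simp
  then have "ln (1 + 1/2 :: real) = ln 2 - 4 * ln rho" by (simp add: ln_rho)
  moreover have "3 * gap 2 = 2 * step 2 - ln (1 + 1/2)" using gap_eq[of 2] by simp
  ultimately show ?thesis using step_2 by argo
qed

lemma ln_quot_eq:
  assumes "k \<ge> 2"
  shows "ln (1 + 1 / real k) - ln (1 + 1 / real (Suc k)) = ln (1 + 1 / (real k * (real k + 2)))"
proof -
  have k: "real k > 0" using assms by simp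
  have "(1 + 1 / real k) = (1 + 1 / real (Suc k)) * (1 + 1 / (real k * (real k + 2)))"
    using k by (simp add: divide_simps) (simp add: algebra_simps)
  moreover have "1 + 1 / real (Suc k) > 0" "1 + 1 / (real k * (real k + 2)) > 0"
    using k by (auto intro!: add_pos_nonneg)
  ultimately show ?thesis by (simp only: ln_mult_pos)
qed

text \<open>Both bounds reproduce themselves under \<open>step_rec\<close>. By \<open>gap_eq\<close> they say \<open>0 < gap k\<close> and
  \<open>gap k \<le> 1 / (k (k + 1))\<close>, which are the two facts on which the branching inequality rests.\<close>

lemma step_bounds:
  assumes "k \<ge> 2"
  shows "ln (1 + 1 / real k) / 2 < step k \<and> step k \<le> 1 / (2 * real k) + ln (1 + 1 / real k) / 2"
  using assms
proof (induction k rule: nat_induct_at_least)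
  case base
  have "ln (3/2::real) + ln (4/3) = ln 2" using ln_mult[of "3/2::real" "4/3"] by simp
  then show ?case using step_2 ln_rho ln_rho_bounds by simp
next
  case (Suc k)
  define a where "a = ln (1 + 1 / real k)"
  define b where "b = ln (1 + 1 / real (Suc k))"
  have k: "real k \<ge> 2" using Suc.hyps by simp
  have ab: "a - b = ln (1 + 1 / (real k * (real k + 2)))"
    unfolding a_def b_def by (rule ln_quot_eq[OF Suc.hyps])
  have pos: "a - b > 0" unfolding ab using k by (intro ln_gt_zero) simp
  have up: "a - b \<le> 1 / (real k * (real k + 2))" unfolding ab using k by (intro ln_add_one_self_le_self) simp
  have rec: "(real k + 1) * step (Suc k) = (real k - 1) * step k + a"
    unfolding a_def by (rule step_rec[OF Suc.hyps])
  have ih: "a / 2 < step k" "step k \<le> 1 / (2 * real k) + a / 2"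
    using Suc.IH unfolding a_def by auto
  have "(real k - 1) * (a/2) + a < (real k + 1) * step (Suc k)"
    unfolding rec using ih k by simp
  then have "(real k + 1) * (a/2) < (real k + 1) * step (Suc k)" by argo
  then have 1: "a/2 < step (Suc k)" by (rule mult_left_less_imp_less) simp
  have "(real k + 1) * step (Suc k) \<le> (real k - 1) * (1 / (2 * real k) + a / 2) + a"
    unfolding rec using ih k by (intro add_mono mult_left_mono) auto
  also have "\<dots> = 1/2 - 1 / (2 * real k) + (real k + 1) * (a / 2)"
    using k by (simp add: field_simps)
  also have "\<dots> \<le> 1/2 + (real k + 1) * (b / 2)"
  proof -
    have "(real k + 1) * (a - b) \<le> (real k + 1) * (1 / (real k * (real k + 2)))"
      using up k by (intro mult_left_mono) auto
    also have "\<dots> \<le> 1 / real k" using k by (simp add: divide_simps)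
    finally have "(real k + 1) * a - (real k + 1) * b \<le> 1 / real k" by (simp only: right_diff_distrib)
    moreover have "1 / (2 * real k) = (1 / real k) / 2" by simp
    moreover have "1/2 - r/2 + p/2 \<le> 1/2 + q/2" if "p - q \<le> r" for p q r :: real
      using that by simp
    ultimately show ?thesis by (simp only: times_divide_eq_right)
  qed
  also have "\<dots> = (real k + 1) * (1 / (2 * real (Suc k)) + b / 2)"
    using k by (simp add: field_simps)
  finally have 2: "step (Suc k) \<le> 1 / (2 * real (Suc k)) + b / 2"
    using k by simp
  show ?case using 1 2 pos unfolding b_def by linarith
qed

lemma step_pos: "k \<ge> 2 \<Longrightarrow> step k > 0"
  using step_bounds[of k] ln_ge_zero[of "1 + 1 / real k"] by linarith

lemma step_le_inverse:
  assumes "k \<ge> 2" shows "real k * step k \<le> 1"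
proof -
  have "ln (1 + 1 / real k) \<le> 1 / real k" by (rule ln_add_one_self_le_self) simp
  then have "step k \<le> 1 / (2 * real k) + (1 / real k) / 2"
    using step_bounds[OF assms] by linarith
  also have "\<dots> = 1 / real k" by simp
  finally show ?thesis using assms by (simp add: field_simps)
qed

lemma gap_pos:
  assumes "k \<ge> 2" shows "gap k > 0"
proof -
  have "(real k + 1) * gap k > 0" using gap_eq[OF assms] step_bounds[OF assms] by simp
  then show ?thesis by (simp add: zero_less_mult_iff)
qed

lemma gap_le: "k \<ge> 2 \<Longrightarrow> gap k * (real k * (real k + 1)) \<le> 1"
proof -
  assume k: "k \<ge> 2"
  have "(real k + 1) * gap k \<le> 1 / real k"
    using gap_eq[OF k] step_bounds[OF k] by simp
  then show ?thesis using k by (simp add: field_simps)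
qed

lemma gap_rec:
  assumes "k \<ge> 2"
  shows "(real k + 2) * gap (Suc k) = (real k - 1) * gap k + ln (1 + 1 / (real k * (real k + 2)))"
  using gap_eq[of k] gap_eq[of "Suc k"] ln_quot_eq[OF assms] assms
  unfolding gap_def by (simp add: algebra_simps)

text \<open>This is what \<open>gap_rec\<close> requires in order to make \<open>gap\<close> decreasing, and it is inherited from \<open>k\<close> to \<open>k + 1\<close>
  because the logarithm decreases in \<open>k\<close>.\<close>

lemma gap_lower:
  assumes "k \<ge> 2"
  shows "ln (1 + 1 / (real k * (real k + 2))) \<le> 3 * gap k"
  using assms
proof (induction k rule: nat_induct_at_least)
  case base
  have "ln (9/8::real) \<le> 9/8 - 1" by (rule ln_le_minus_one) simp
  then show ?case using ln_rho_bounds by (simp add: gap_2)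
next
  case (Suc k)
  define a where "a = ln (1 + 1 / (real k * (real k + 2)))"
  have k: "real k \<ge> 2" using Suc.hyps by simp
  have "ln (1 + 1 / (real (Suc k) * (real (Suc k) + 2))) \<le> a"
    unfolding a_def using k by (subst ln_le_cancel_iff) (auto intro!: add_pos_pos divide_left_mono mult_mono mult_pos_pos)
  moreover have "a \<le> 3 * gap (Suc k)"
  proof -
    have "(real k - 1) * a \<le> (real k - 1) * (3 * gap k)"
      using Suc.IH k unfolding a_def by (intro mult_left_mono) auto
    then have "(real k + 2) * a \<le> (real k + 2) * (3 * gap (Suc k))"
      using gap_rec[OF Suc.hyps] unfolding a_def by (simp add: algebra_simps)
    then show ?thesis using k by simp
  qed
  ultimately show ?case by linarith
qed

lemma gap_antimono_Suc: "k \<ge> 2 \<Longrightarrow> gap (Suc k) \<le> gap k"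
proof -
  assume k: "k \<ge> 2"
  have "(real k + 2) * gap (Suc k) \<le> (real k + 2) * gap k"
    using gap_rec[OF k] gap_lower[OF k] by (simp add: algebra_simps)
  then show ?thesis by simp
qed

lemma ln_9_8: "12 * ln (9/8::real) \<le> 5 * ln (4/3)"
proof -
  have "ln ((9/8::real)^12) \<le> ln ((4/3)^5)" by (simp add: power_divide)
  then show ?thesis by (simp only: ln_realpow)
qed

text \<open>Equality holds for \<open>k = 2\<close>. The recurrence preserves the bound as soon as the logarithm in it is
  small against \<open>ln \<rho>\<close>; a crude estimate does for \<open>k \<ge> 3\<close>, while the step from 2 to 3
  comes down to \<open>(9/8)\<^sup>1\<^sup>2 \<le> (4/3)\<^sup>5\<close>.\<close>

lemma mult_gap_le:
  assumes "k \<ge> 2"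
  shows "real k * gap k \<le> 2 * ln rho"
  using assms
proof (induction k rule: nat_induct_at_least)
  case base then show ?case by (simp add: gap_2)
next
  case (Suc k)
  define a where "a = ln (1 + 1 / (real k * (real k + 2)))"
  have k: "real k \<ge> 2" using Suc.hyps by simp
  \<comment> \<open>What remains of the claim for \<open>k + 1\<close> after inserting the bound for \<open>k\<close> into \<open>gap_rec\<close>.\<close>
  have a: "a * (real k * (real k + 1)) \<le> 2 * ln rho * (2 * real k + 1)"
  proof (cases "k = 2")
    case True
    then show ?thesis using ln_9_8 by (simp add: a_def ln_rho)
  next
    case False
    then have k3: "real k \<ge> 3" using Suc.hyps by simp
    have up: "a \<le> 1 / (real k * (real k + 2))" unfolding a_def using k by (intro ln_add_one_self_le_self) simp
    have "a * (real k * (real k + 1)) \<le> (real k + 1) / (real k + 2)"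
    proof -
      have "a * (real k * (real k + 1)) \<le> 1 / (real k * (real k + 2)) * (real k * (real k + 1))"
        using up k by (intro mult_right_mono) auto
      also have "\<dots> = (real k + 1) / (real k + 2)" using k by simp
      finally show ?thesis .
    qed
    also have "\<dots> \<le> 1/8 * (2 * real k + 1)"
    proof -
      have "0 \<le> (real k - 3) * (2 * real k + 3)" using k3 by simp
      then show ?thesis using k3 by (simp add: field_simps)
    qed
    also have "\<dots> \<le> 2 * ln rho * (2 * real k + 1)"
      using ln_rho_bounds k by (intro mult_right_mono) auto
    finally show ?thesis .
  qed
  have "real k * ((real k + 2) * gap (Suc k)) = (real k - 1) * (real k * gap k) + real k * a"
    unfolding gap_rec[OF Suc.hyps] a_def by (simp add: algebra_simps)
  also have "\<dots> \<le> (real k - 1) * (2 * ln rho) + real k * a"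
    using Suc.IH k by (intro add_mono mult_left_mono) auto
  finally have "(real k + 1) * (real k * ((real k + 2) * gap (Suc k)))
      \<le> (real k + 1) * ((real k - 1) * (2 * ln rho) + real k * a)"
    by (rule mult_left_mono) simp
  then have "real k * (real k + 2) * (real (Suc k) * gap (Suc k))
      \<le> (real k + 1) * ((real k - 1) * (2 * ln rho) + real k * a)"
    by (simp add: mult_ac add_ac)
  also have "\<dots> = (real k + 1) * (real k - 1) * (2 * ln rho) + a * (real k * (real k + 1))"
    by (simp add: algebra_simps)
  also have "\<dots> \<le> (real k + 1) * (real k - 1) * (2 * ln rho) + 2 * ln rho * (2 * real k + 1)"
    using a by simp
  also have "\<dots> = real k * (real k + 2) * (2 * ln rho)" by (simp add: algebra_simps)
  finally show ?case using k by simp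
qed

section \<open>The branching inequality\<close>

text \<open>The recursion puts \<open>(step (k+1), branch (k+1))\<close> on the line of slope \<open>k branch k\<close> through
  \<open>(step k, branch k)\<close>. The initial value makes \<open>start 2 = b(3)\<close>, the largest value that allows
  \<open>start 1 = 1\<close> when the path is forced to move on to a vertex of degree 3 (\<open>start_le_wt\<close>).\<close>

primrec branch :: "nat \<Rightarrow> real" where
  "branch 0 = 1"
| "branch (Suc k) = (if k < 2 then exp (step 2) else branch k * (1 - real k * gap k))"

declare branch.simps(2) [simp del]

text \<open>The weight of the current end of a path, by the number of edges it has left. The value 0 at 0 makes
  a dead end contribute nothing, however large the weight of the other vertices.\<close>

definition start :: "nat \<Rightarrow> real" where
  "start k = (if k = 0 then 0 else if k = 1 then 1 else branch k * wt k)"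

text \<open>The point \<open>(l, y)\<close> may stand for an edge to a neighbour: deleting it multiplies the weight of the
  neighbour by \<open>exp (- l)\<close>, and using it by a further factor \<open>y\<close>. It has to lie below the lines that belong to all possible degrees \<open>k\<close> of the
  current end.\<close>

definition admissible :: "real \<Rightarrow> real \<Rightarrow> bool" where
  "admissible l y \<longleftrightarrow> (\<forall>k\<ge>2. y \<le> branch k + real k * branch k * (l - step k))"

lemma branch_2: "branch 2 = exp (step 2)"
  by (simp add: numeral_2_eq_2 branch.simps)

lemma branch_Suc: "k \<ge> 2 \<Longrightarrow> branch (Suc k) = branch k * (1 - real k * gap k)"
  by (simp add: branch.simps)

text \<open>Equivalently, \<open>k branch k\<close> does not decrease.\<close>

lemma branch_factor:
  assumes "k \<ge> 2" shows "real k / (real k + 1) \<le> 1 - real k * gap k"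
proof -
  have "real k * gap k \<le> 1 / (real k + 1)"
    using gap_le[OF assms] by (simp add: field_simps)
  moreover have "real k / (real k + 1) = 1 - 1 / (real k + 1)" by (simp add: field_simps)
  ultimately show ?thesis by linarith
qed

lemma branch_pos: "k \<ge> 2 \<Longrightarrow> branch k > 0"
proof (induction k rule: nat_induct_at_least)
  case base then show ?case by (simp add: branch_2)
next
  case (Suc k)
  have "0 < real k / (real k + 1)" using Suc.hyps by simp
  then have "0 < 1 - real k * gap k" using branch_factor[OF Suc.hyps] by linarith
  then show ?case using Suc by (simp add: branch_Suc)
qed

lemma branch_diff: "k \<ge> 2 \<Longrightarrow> branch k - branch (Suc k) = real k * branch k * gap k"
  by (simp add: branch_Suc algebra_simps)

lemma branch_antimono:
  assumes "2 \<le> j" "j \<le> k" shows "branch k \<le> branch j"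
  using assms(2)
proof (induction k rule: nat_induct_at_least)
  case (Suc k)
  then have "k \<ge> 2" using assms(1) by simp
  then have "0 \<le> real k * branch k * gap k"
    using branch_pos[of k] gap_pos[of k] by simp
  then show ?case using branch_diff[OF \<open>k \<ge> 2\<close>] Suc.IH by linarith
qed simp

lemma mult_branch_mono:
  assumes "2 \<le> j" "j \<le> k" shows "real j * branch j \<le> real k * branch k"
  using assms(2)
proof (induction k rule: nat_induct_at_least)
  case (Suc k)
  then have k: "k \<ge> 2" using assms(1) by simp
  have "branch k * (real k / (real k + 1)) \<le> branch (Suc k)"
    unfolding branch_Suc[OF k] using branch_factor[OF k] branch_pos[OF k]
    by (intro mult_left_mono) auto
  then have "real k * branch k \<le> real (Suc k) * branch (Suc k)" by (simp add: field_simps)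
  then show ?case using Suc.IH by linarith
qed simp

text \<open>The slope between the points for \<open>j\<close> and \<open>j + 1\<close> is \<open>j branch j\<close>. As this increases with \<open>j\<close> while
  \<open>step j\<close> decreases, the points lie on the graph of a concave function, and the line for \<open>k\<close> extends one of
  its edges.\<close>

lemma admissible_step: 
  assumes j: "j \<ge> 2" shows "admissible (step j) (branch j)"
  unfolding admissible_def
proof (intro allI impI)
  fix k :: nat assume k: "2 \<le> k"
  show "branch j \<le> branch k + real k * branch k * (step j - step k)"
  proof (cases "k \<le> j")
    case True
    then show ?thesis
    proof (induction j rule: nat_induct_at_least)
      case (Suc j)
      then have j: "j \<ge> 2" using k by simp
      have "real k * branch k * gap j \<le> real j * branch j * gap j"
        using mult_branch_mono[OF k Suc.hyps] gap_pos[OF j] by (intro mult_right_mono) auto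
      then show ?case using Suc.IH branch_diff[OF j]
        unfolding gap_def by (simp add: algebra_simps)
    qed simp
  next
    case False
    then have "j \<le> k" by simp
    then show ?thesis using j
    proof (induction j rule: inc_induct)
      case (step j)
      have "real j * branch j * gap j \<le> real k * branch k * gap j"
        using mult_branch_mono[of j k] step gap_pos[of j] by (intro mult_right_mono) auto
      then show ?case using step.IH branch_diff[of j] step.prems
        unfolding gap_def by (simp add: algebra_simps)
    qed simp
  qed
qed

text \<open>The point of a useless edge, to a neighbour from which no path continues.\<close>

lemma admissible_0: "admissible 0 0"
  unfolding admissible_def
proof (intro allI impI)
  fix k :: nat assume k: "2 \<le> k"
  have "0 \<le> branch k * (1 - real k * step k)"
    using branch_pos[OF k] step_le_inverse[OF k] by simp
  then show "0 \<le> branch k + real k * branch k * (0 - step k)" by (simp add: algebra_simps)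
qed

lemma exp_step: "exp (step k) = wt (Suc k) / wt k"
  by (simp add: step_def exp_diff)

lemma exp_mult_step: 
  assumes "k \<ge> 2" shows "exp (- (real k * step k)) = wt k / real k"
proof -
  have "- (real k * step k) = ln (wt k) - ln (real k)" using step_eq[OF assms] by simp
  then show ?thesis using assms by (simp add: exp_diff)
qed

lemma start_eq: "k \<ge> 2 \<Longrightarrow> start k = branch k * wt k"
  by (simp add: start_def)

text \<open>The induction step for counting paths, in normalised form. For a neighbour \<open>v\<close> joined by \<open>m v\<close> edges,
  \<open>R v\<close> is the ratio of the new to the old weight of \<open>v\<close> if the path goes elsewhere, and \<open>T v\<close> is \<open>m v\<close> times
  this ratio if the path goes to \<open>v\<close>.
  With \<open>X\<close> the sum of all \<open>m v * l v\<close>, admissibility bounds the sum of all \<open>m v * y v\<close> by a linear function of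
  \<open>X\<close>, and \<open>(1 + X - c) exp (- X) \<le> exp (- c)\<close> removes \<open>X\<close>.\<close>

lemma start_branching:
  fixes m :: "'b \<Rightarrow> nat"
  assumes N: "finite N" and k: "(\<Sum>v\<in>N. m v) = k" "k \<ge> 2"
    and adm: "\<And>v. v \<in> N \<Longrightarrow> admissible (l v) (y v)"
    and R: "\<And>v. v \<in> N \<Longrightarrow> 0 \<le> R v" "\<And>v. v \<in> N \<Longrightarrow> R v \<le> exp (- (real (m v) * l v))"
    and T: "\<And>v. v \<in> N \<Longrightarrow> 0 \<le> T v" "\<And>v. v \<in> N \<Longrightarrow> T v \<le> real (m v) * y v * exp (- (real (m v) * l v))"
  shows "(\<Sum>u\<in>N. T u * (\<Prod>v\<in>N-{u}. R v)) \<le> start k"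
proof -
  define X where "X = (\<Sum>v\<in>N. real (m v) * l v)"
  have pos: "branch k > 0" using branch_pos k by simp
  have m: "(\<Sum>v\<in>N. real (m v)) = real k" using k(1) by (simp flip: of_nat_sum)
  have "(\<Sum>u\<in>N. T u * (\<Prod>v\<in>N-{u}. R v)) \<le>
      (\<Sum>u\<in>N. real (m u) * y u * exp (- X))"
  proof (intro sum_mono)
    fix u assume u: "u \<in> N"
    have "(\<Prod>v\<in>N-{u}. R v) \<le> (\<Prod>v\<in>N-{u}. exp (- (real (m v) * l v)))"
      using R by (intro prod_mono) auto
    moreover have "0 \<le> (\<Prod>v\<in>N-{u}. R v)" using R by (intro prod_nonneg) auto
    ultimately have "T u * (\<Prod>v\<in>N-{u}. R v) \<le>
        (real (m u) * y u * exp (- (real (m u) * l u))) * (\<Prod>v\<in>N-{u}. exp (- (real (m v) * l v)))"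
      using T[OF u] by (intro mult_mono) auto
    also have "\<dots> = real (m u) * y u * (\<Prod>v\<in>N. exp (- (real (m v) * l v)))"
      using N u by (simp add: prod.remove)
    also have "(\<Prod>v\<in>N. exp (- (real (m v) * l v))) = exp (- X)"
      using N by (simp add: X_def exp_sum sum_negf flip: sum_negf)
    finally show "T u * (\<Prod>v\<in>N-{u}. R v) \<le> real (m u) * y u * exp (- X)" .
  qed
  also have "\<dots> = (\<Sum>u\<in>N. real (m u) * y u) * exp (- X)" by (simp add: sum_distrib_right)
  also have "\<dots> \<le> (real k * branch k * (1 + (X - real k * step k))) * exp (- X)"
  proof (intro mult_right_mono)
    have "(\<Sum>u\<in>N. real (m u) * y u) \<le>
        (\<Sum>u\<in>N. real (m u) * (branch k + real k * branch k * (l u - step k)))"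
      using adm k by (intro sum_mono mult_left_mono) (auto simp: admissible_def)
    also have "\<dots> = branch k * (\<Sum>u\<in>N. real (m u)) + real k * branch k * X
        - real k * branch k * step k * (\<Sum>u\<in>N. real (m u))"
      unfolding X_def by (simp add: sum_distrib_left sum.distrib sum_subtractf algebra_simps)
    also have "\<dots> = real k * branch k * (1 + (X - real k * step k))"
      unfolding m by (simp add: algebra_simps)
    finally show "(\<Sum>u\<in>N. real (m u) * y u) \<le> real k * branch k * (1 + (X - real k * step k))" .
  qed simp
  also have "\<dots> \<le> (real k * branch k * exp (X - real k * step k)) * exp (- X)"
    using pos by (intro mult_right_mono mult_left_mono exp_ge_add_one_self) auto
  also have "\<dots> = real k * branch k * exp (- (real k * step k))"
    by (simp add: mult.assoc flip: exp_add)
  also have "\<dots> = start k"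
    using k by (simp add: exp_mult_step start_eq)
  finally show ?thesis .
qed

lemma wt_Suc_mono: "wt k \<le> wt (Suc k)"
proof (cases "k \<ge> 2")
  case True
  have "1 \<le> exp (step k)" using step_pos[OF True] by simp
  then show ?thesis by (simp add: exp_step)
next
  case False
  then show ?thesis using wt_ge1[of "Suc k"] by (simp add: wt_def[of k])
qed

lemma wt_mono: "j \<le> k \<Longrightarrow> wt j \<le> wt k"
  using wt_Suc_mono by (rule lift_Suc_mono_le)

lemma start_2: "start 2 = wt 3"
  using exp_step[of 2] by (simp add: start_eq branch_2)

text \<open>With \<open>x = step k\<close> and \<open>a = ln (1 + 1/k)\<close> the factor \<open>1 - k gap k\<close> in the recursion equals
  \<open>1 - exp (- a) (2 x - a)\<close>, and this must be at least \<open>exp (- x)\<close>. For \<open>x \<ge> a\<close> the bound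
  \<open>k/(k+1) = exp (- a)\<close> suffices, otherwise \<open>1 + x \<le> exp x\<close> does.\<close>

lemma start_Suc_mono: "start k \<le> start (Suc k)"
proof (cases "k \<ge> 2")
  case True
  define x where "x = step k"
  define a where "a = ln (1 + 1 / real k)"
  have x: "x > 0" using step_pos[OF True] by (simp add: x_def)
  have ea: "exp (- a) = real k / (real k + 1)"
    using True by (simp add: a_def exp_minus field_simps)
  have "exp (- x) \<le> 1 - real k * gap k"
  proof (cases "a \<le> x")
    case True
    then have "exp (- x) \<le> exp (- a)" by simp
    then show ?thesis using branch_factor[OF \<open>k \<ge> 2\<close>] ea by simp
  next
    case False
    have "gap k = (2 * x - a) / (real k + 1)"
      using gap_eq[OF True] by (simp add: x_def a_def field_simps)
    then have "real k * gap k = exp (- a) * (2 * x - a)" by (simp add: ea)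
    also have "\<dots> \<le> exp (- a) * x" using False by (intro mult_left_mono) auto
    also have "\<dots> \<le> exp (- x) * x" using False x by (intro mult_right_mono) auto
    finally have "real k * gap k + exp (- x) \<le> exp (- x) * (1 + x)" by (simp add: algebra_simps)
    also have "\<dots> \<le> exp (- x) * exp x" by (intro mult_left_mono exp_ge_add_one_self) auto
    also have "\<dots> = 1" by (simp flip: exp_add)
    finally show ?thesis by simp
  qed
  then have "1 \<le> (1 - real k * gap k) * exp x"
    by (simp add: exp_minus field_simps)
  then have "branch k * wt k * 1 \<le> branch k * wt k * ((1 - real k * gap k) * exp x)"
    using branch_pos[OF True] by (intro mult_left_mono) (auto intro: less_imp_le)
  also have "\<dots> = branch (Suc k) * wt (Suc k)"
    using True by (simp add: branch_Suc x_def exp_step)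
  finally show ?thesis using True by (simp add: start_eq)
next
  case False
  then have "k = 0 \<or> k = 1" by auto
  then show ?thesis using start_2 wt_ge1[of 3] by (auto simp: start_def numeral_2_eq_2)
qed

lemma start_mono: "j \<le> k \<Longrightarrow> start j \<le> start k"
  using start_Suc_mono by (rule lift_Suc_mono_le)

lemma start_ge1: "k \<ge> 1 \<Longrightarrow> start k \<ge> 1"
  using start_mono[of 1 k] by (simp add: start_def)

lemma start_nonneg: "start k \<ge> 0"
  using start_mono[of 0 k] by (simp add: start_def)

lemma step_antimono:
  assumes "2 \<le> j" "j \<le> k" shows "step k \<le> step j"
  using assms(2)
proof (induction k rule: nat_induct_at_least)
  case (Suc k)
  then show ?case using gap_pos[of k] assms unfolding gap_def by simp
qed simp

text \<open>The case of a forced move: the path runs along its only remaining edge to a vertex with \<open>j\<close> further edges.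
  The line for \<open>k = 2\<close> gives it for \<open>j \<ge> 2\<close>.\<close>

lemma start_le_wt:
  assumes "j \<ge> 1" shows "start j \<le> wt (Suc j)"
proof (cases "j = 1")
  case True
  then show ?thesis using wt_ge1 by (simp add: start_def)
next
  case False
  then have j: "j \<ge> 2" using assms by simp
  have "branch j \<le> branch 2 + 2 * branch 2 * (step j - step 2)"
    using admissible_step[OF j] unfolding admissible_def by force
  also have "\<dots> = branch 2 * (1 + 2 * (step j - step 2))" by (simp add: algebra_simps)
  also have "\<dots> \<le> branch 2 * exp (2 * (step j - step 2))"
    using branch_pos[of 2] by (intro mult_left_mono exp_ge_add_one_self) auto
  also have "\<dots> = exp (step j + (step j - step 2))"
    by (simp add: branch_2 algebra_simps flip: exp_add)
  also have "\<dots> \<le> exp (step j)" using step_antimono[of 2 j] j by simp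
  finally have "branch j * wt j \<le> exp (step j) * wt j" by simp
  then show ?thesis using j wt_pos[of j] by (simp add: start_eq exp_step)
qed

section \<open>Estimates for parallel edges\<close>

lemma wt_pow4:
  assumes "n \<ge> 2" shows "wt n ^ (4 * (n - 1)) = fact (n - 1) ^ 4 * (4/3)"
proof -
  obtain N where n: "n = Suc (Suc N)" using assms by (metis add_2_eq_Suc le_Suc_ex)
  have "wt n ^ (4 * (n - 1)) = (wt n ^ Suc N) ^ 4" by (simp add: n mult.commute del: power_Suc flip: power_mult)
  also have "\<dots> = (fact (Suc N) * rho) ^ 4" unfolding n wt_pow ..
  also have "\<dots> = fact (n - 1) ^ 4 * (4/3)" by (simp only: power_mult_distrib rho_pow4) (simp add: n)
  finally show ?thesis .
qed

lemma power_le_cancel: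
  fixes x y :: real
  assumes "x ^ n \<le> y ^ n" "n > 0" "y \<ge> 0"
  shows "x \<le> y"
  using assms power_less_imp_less_base[of y n x] by (meson linorder_not_less power_strict_mono)

text \<open>Raising to the power \<open>4 (n - 1)\<close> turns the claim, for numerals, into an inequality between natural
  numbers. Here \<open>wt n * rho ^ (m - 1)\<close> is the weight carried by a vertex of degree \<open>n\<close> that is joined to
  the current end by \<open>m\<close> edges.\<close>

lemma le_wt_rho_power:
  assumes "n \<ge> 2" "b > 0"
    and "(m * b) ^ (4 * (n - 1)) * 3 ^ Suc ((m - 1) * (n - 1))
      \<le> (a ^ (n - 1) * fact (n - 1)) ^ 4 * 4 ^ Suc ((m - 1) * (n - 1))"
  shows "real m \<le> (real a / real b) * (wt n * rho ^ (m - 1))"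
proof -
  define N where "N = n - 1"
  define K where "K = (m - 1) * N"
  have "(real a * (wt n * rho ^ (m - 1))) ^ (4 * N) =
      (real a ^ N) ^ 4 * (wt n ^ (4 * N) * (rho ^ 4) ^ K)"
    by (simp add: K_def power_mult_distrib mult_ac flip: power_mult)
  also have "\<dots> = (real a ^ N * fact N) ^ 4 * (4/3) ^ Suc K"
    unfolding N_def by (simp only: wt_pow4[OF assms(1)] rho_pow4) (simp add: power_mult_distrib)
  finally have eq: "(real a * (wt n * rho ^ (m - 1))) ^ (4 * N) = (real a ^ N * fact N) ^ 4 * (4/3) ^ Suc K" .
  have "real ((m * b) ^ (4 * N) * 3 ^ Suc K) \<le> real ((a ^ N * fact N) ^ 4 * 4 ^ Suc K)"
    using assms(3) unfolding N_def[symmetric] K_def[symmetric] of_nat_le_iff .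
  then have "(real m * real b) ^ (4 * N) * 3 ^ Suc K \<le> (real a ^ N * fact N) ^ 4 * 4 ^ Suc K"
    by (simp only: of_nat_mult of_nat_power of_nat_fact of_nat_numeral)
  then have "(real m * real b) ^ (4 * N) \<le> (real a * (wt n * rho ^ (m - 1))) ^ (4 * N)"
    unfolding eq by (simp add: power_divide field_simps del: power_Suc)
  then have "real m * real b \<le> real a * (wt n * rho ^ (m - 1))"
    by (rule power_le_cancel) (use assms(1) rho_pos in \<open>auto simp: N_def less_imp_le\<close>)
  then show ?thesis using assms(2) by (simp add: field_simps)
qed

lemma wt_le:
  assumes "n \<ge> 2" "C \<ge> 0" "fact (n - 1) ^ 4 * (4/3) \<le> C ^ (4 * (n - 1))"
  shows "wt n \<le> C"
proof (rule power_le_cancel)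
  show "wt n ^ (4 * (n - 1)) \<le> C ^ (4 * (n - 1))" using assms(3) unfolding wt_pow4[OF assms(1)] .
qed (use assms in auto)

lemma le_wt:
  assumes "n \<ge> 2" "C \<ge> 0" "C ^ (4 * (n - 1)) \<le> fact (n - 1) ^ 4 * (4/3)"
  shows "C \<le> wt n"
proof (rule power_le_cancel)
  show "C ^ (4 * (n - 1)) \<le> wt n ^ (4 * (n - 1))" using assms(3) unfolding wt_pow4[OF assms(1)] .
qed (use assms in \<open>auto simp: less_imp_le\<close>)

text \<open>Raising the multiplicity from \<open>m\<close> to \<open>m + 1\<close> multiplies the bound by at least \<open>(m+1)/m\<close>. The simple
  estimates \<open>2 step k > ln (1 + 1/k)\<close> and \<open>\<rho>\<^sup>2 \<ge> 15/13\<close> show this for \<open>m \<ge> 9\<close>, not for smaller \<open>m\<close> when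
  \<open>j = 5\<close>.\<close>

lemma rho_growth:
  assumes "m \<ge> 9" "j \<le> 5"
  shows "(1 + 1 / real m) * wt (m + j) \<le> wt (Suc m + j) * rho"
proof -
  have m: "real m \<ge> 9" using assms by simp
  have rho2: "15/13 \<le> rho ^ 2"
  proof (rule power_le_cancel[of _ 2])
    show "(15/13) ^ 2 \<le> (rho ^ 2) ^ 2" using rho_pow4 by (simp add: power_divide flip: power_mult)
  qed (use rho_pos in auto)
  have s: "1 + 1 / real (m + j) \<le> exp (step (m + j)) ^ 2"
  proof -
    have "ln (1 + 1 / real (m + j)) \<le> 2 * step (m + j)"
      using step_bounds[of "m + j"] assms by simp
    then have "exp (ln (1 + 1 / real (m + j))) \<le> exp (2 * step (m + j))" by simp
    then show ?thesis using m by (simp add: exp_double add_pos_nonneg)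
  qed
  \<comment> \<open>The polynomial \<open>2 m\<^sup>3 - m\<^sup>2 - 143 m - 65\<close> that remains after clearing denominators below.\<close>
  have "0 \<le> (real m - 9) * (2 * real m * real m + 17 * real m + 10) + 25"
    using m by (intro add_nonneg_nonneg mult_nonneg_nonneg) auto
  then have "real m * real m + (65 + real m * 143) \<le> real m * (real m * (real m * 2))"
    by (simp add: algebra_simps)
  then have "(1 + 1 / real m) ^ 2 \<le> (1 + 1 / (real m + 5)) * (15/13)"
    using m by (simp add: divide_simps power2_eq_square) (simp add: algebra_simps)
  also have "\<dots> \<le> (1 + 1 / real (m + j)) * (15/13)"
    using m assms by (intro mult_right_mono add_left_mono divide_left_mono) auto
  also have "\<dots> \<le> exp (step (m + j)) ^ 2 * rho ^ 2"
    using s rho2 by (intro mult_mono) auto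
  also have "\<dots> = (exp (step (m + j)) * rho) ^ 2" by (simp add: power_mult_distrib)
  finally have "1 + 1 / real m \<le> exp (step (m + j)) * rho"
    by (rule power2_le_imp_le) (use rho_pos in auto)
  then show ?thesis using wt_pos[of "m + j"] by (simp add: exp_step field_simps)
qed

lemma le_wt_rho_power_induct:
  assumes small: "\<And>m. a \<le> m \<Longrightarrow> m \<le> 9 \<Longrightarrow> real m \<le> C * (wt (m + j) * rho ^ (m - 1))"
    and "C \<ge> 0" "j \<le> 5" "a \<le> 9" "a \<le> m"
  shows "real m \<le> C * (wt (m + j) * rho ^ (m - 1))"
proof (cases "m \<le> 9")
  case True
  then show ?thesis using assms by simp
next
  case False
  then have "9 \<le> m" by simp
  then show ?thesis
  proof (induction m rule: nat_induct_at_least)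
    case base
    show ?case using small[of 9] assms(4) by simp
  next
    case (Suc m)
    have "real (Suc m) = (1 + 1 / real m) * real m" using Suc.hyps by (simp add: field_simps)
    also have "\<dots> \<le> (1 + 1 / real m) * (C * (wt (m + j) * rho ^ (m - 1)))"
      using Suc.IH by (intro mult_left_mono) auto
    also have "\<dots> = C * (((1 + 1 / real m) * wt (m + j)) * rho ^ (m - 1))"
      by (simp only: mult_ac)
    also have "\<dots> \<le> C * ((wt (Suc m + j) * rho) * rho ^ (m - 1))"
      using rho_growth[OF Suc.hyps \<open>j \<le> 5\<close>] assms(2) rho_pos
      by (intro mult_left_mono mult_right_mono) auto
    also have "\<dots> = C * (wt (Suc m + j) * rho ^ (Suc m - 1))"
      using Suc.hyps by (cases m) auto
    finally show ?case .
  qed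
qed

text \<open>In the following lemmas \<open>j\<close> is the number of edges that the neighbour has besides the \<open>m\<close> parallel
  ones. For small \<open>j\<close> the weight alone does not reach \<open>m\<close>; the constants are what the growth of
  \<open>start\<close> can make up for, see \<open>start_growth\<close>. For \<open>j = 1\<close> the constant only has to stay below \<open>b(3)\<close>.\<close>

lemma le_wt_rho_power_1:
  assumes "m \<ge> 2" shows "real m \<le> real 13 / real 9 * (wt (m + 1) * rho ^ (m - 1))"
proof (rule le_wt_rho_power_induct[where a = 2])
  fix m :: nat assume "2 \<le> m" "m \<le> 9"
  then have "m = 2 \<or> m = 3 \<or> m = 4 \<or> m = 5 \<or> m = 6 \<or> m = 7 \<or> m = 8 \<or> m = 9" by presburger
  then show "real m \<le> real 13 / real 9 * (wt (m + 1) * rho ^ (m - 1))"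
    by (elim disjE; hypsubst; intro le_wt_rho_power; simp add: fact_numeral)
qed (use assms in auto)

lemma le_wt_rho_power_2:
  assumes "m \<ge> 4" shows "real m \<le> real 5 / real 4 * (wt (m + 2) * rho ^ (m - 1))"
proof (rule le_wt_rho_power_induct[where a = 4])
  fix m :: nat assume "4 \<le> m" "m \<le> 9"
  then have "m = 4 \<or> m = 5 \<or> m = 6 \<or> m = 7 \<or> m = 8 \<or> m = 9" by presburger
  then show "real m \<le> real 5 / real 4 * (wt (m + 2) * rho ^ (m - 1))"
    by (elim disjE; hypsubst; intro le_wt_rho_power; simp add: fact_numeral)
qed (use assms in auto)

lemma le_wt_rho_power_3:
  assumes "m \<ge> 5" shows "real m \<le> real 28 / real 25 * (wt (m + 3) * rho ^ (m - 1))"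
proof (rule le_wt_rho_power_induct[where a = 5])
  fix m :: nat assume "5 \<le> m" "m \<le> 9"
  then have "m = 5 \<or> m = 6 \<or> m = 7 \<or> m = 8 \<or> m = 9" by presburger
  then show "real m \<le> real 28 / real 25 * (wt (m + 3) * rho ^ (m - 1))"
    by (elim disjE; hypsubst; intro le_wt_rho_power; simp add: fact_numeral)
qed (use assms in auto)

lemma le_wt_rho_power_4:
  assumes "m \<ge> 5" shows "real m \<le> real 101 / real 100 * (wt (m + 4) * rho ^ (m - 1))"
proof (rule le_wt_rho_power_induct[where a = 5])
  fix m :: nat assume "5 \<le> m" "m \<le> 9"
  then have "m = 5 \<or> m = 6 \<or> m = 7 \<or> m = 8 \<or> m = 9" by presburger
  then show "real m \<le> real 101 / real 100 * (wt (m + 4) * rho ^ (m - 1))"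
    by (elim disjE; hypsubst; intro le_wt_rho_power; simp add: fact_numeral)
qed (use assms in auto)

lemma le_wt_rho_power_5:
  assumes "m \<ge> 5" shows "real m \<le> real 1 / real 1 * (wt (m + 5) * rho ^ (m - 1))"
proof (rule le_wt_rho_power_induct[where a = 5])
  fix m :: nat assume "5 \<le> m" "m \<le> 9"
  then have "m = 5 \<or> m = 6 \<or> m = 7 \<or> m = 8 \<or> m = 9" by presburger
  then show "real m \<le> real 1 / real 1 * (wt (m + 5) * rho ^ (m - 1))"
    by (elim disjE; hypsubst; intro le_wt_rho_power; simp add: fact_numeral)
qed (use assms in auto)

text \<open>The remaining cases with \<open>j \<le> m\<close> for \<open>j = 2, 3, 4\<close>. The first one is an equality.\<close>

lemma le_wt_rho_power_small:
  "2 \<le> wt 4 * rho" "3 \<le> 29/25 * (wt 5 * rho ^ 2)" "3 \<le> wt 6 * rho ^ 2"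
  "4 \<le> 43/40 * (wt 7 * rho ^ 3)" "4 \<le> wt 8 * rho ^ 3"
  using le_wt_rho_power[of 4 1 2 1] le_wt_rho_power[of 5 25 3 29] le_wt_rho_power[of 6 1 3 1]
    le_wt_rho_power[of 7 40 4 43] le_wt_rho_power[of 8 1 4 1]
  by (simp_all add: fact_numeral)

lemma rho_bounds: "10745/10000 \<le> rho" "rho \<le> 10746/10000"
  using le_wt[of 2 "10745/10000"] wt_le[of 2 "10746/10000"] by (simp_all add: wt_2 power_divide)

lemma wt_3_bounds: "14659/10000 \<le> wt 3" "wt 3 \<le> 14661/10000"
  using le_wt[of 3 "14659/10000"] wt_le[of 3 "14661/10000"] by (simp_all add: power_divide fact_numeral)

lemma wt_4_bounds: "1861/1000 \<le> wt 4" "wt 4 \<le> 1862/1000"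
  using le_wt[of 4 "1861/1000"] wt_le[of 4 "1862/1000"] by (simp_all add: power_divide fact_numeral)

lemma wt_5_bounds: "2253/1000 \<le> wt 5" "wt 5 \<le> 2254/1000"
  using le_wt[of 5 "2253/1000"] wt_le[of 5 "2254/1000"] by (simp_all add: power_divide fact_numeral)

text \<open>Upper bounds suffice, since \<open>gap k\<close> enters \<open>branch\<close> with a negative sign.\<close>

lemma gap_bounds: "gap 2 \<le> 0.07275" "gap 3 \<le> 0.0495" "gap 4 \<le> 0.0332"
proof -
  show 2: "gap 2 \<le> 0.07275" using ln_rho_bounds by (simp add: gap_2)
  have "ln (9/8::real) \<le> 9/8 - 1" by (rule ln_le_minus_one) simp
  then show 3: "gap 3 \<le> 0.0495" using gap_rec[of 2] 2 by simp
  have "ln (16/15::real) \<le> 16/15 - 1" by (rule ln_le_minus_one) simp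
  then show "gap 4 \<le> 0.0332" using gap_rec[of 3] 3 by simp
qed

lemma branch_lower:
  "0.8545 * branch 2 \<le> branch 3" "0.8515 * branch 3 \<le> branch 4" "0.867 * branch 4 \<le> branch 5"
proof -
  have "0.8545 * branch 2 \<le> (1 - 2 * gap 2) * branch 2" using gap_bounds branch_pos[of 2] by (intro mult_right_mono) auto
  then show "0.8545 * branch 2 \<le> branch 3" using branch_Suc[of 2] by (simp add: mult.commute)
  have "0.8515 * branch 3 \<le> (1 - 3 * gap 3) * branch 3" using gap_bounds branch_pos[of 3] by (intro mult_right_mono) auto
  then show "0.8515 * branch 3 \<le> branch 4" using branch_Suc[of 3] by (simp add: mult.commute)
  have "0.867 * branch 4 \<le> (1 - 4 * gap 4) * branch 4" using gap_bounds branch_pos[of 4] by (intro mult_right_mono) auto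
  then show "0.867 * branch 4 \<le> branch 5" using branch_Suc[of 4] by (simp add: mult.commute)
qed

lemma start_ratio:
  assumes "c * branch j \<le> branch k" "a \<le> wt k" "wt j \<le> b" "d * b \<le> c * a" 
    and "2 \<le> j" "2 \<le> k" "0 \<le> c" "0 \<le> d"
  shows "d * start j \<le> start k"
proof -
  have "d * start j = branch j * (d * wt j)" using assms by (simp add: start_eq)
  also have "\<dots> \<le> branch j * (d * b)" using assms branch_pos[of j] by (intro mult_left_mono) auto
  also have "\<dots> \<le> branch j * (c * a)" using assms branch_pos[of j] by (intro mult_left_mono) auto
  also have "\<dots> = (c * branch j) * a" by simp
  also have "\<dots> \<le> (c * branch j) * wt k" using assms branch_pos[of j] by (intro mult_left_mono) auto
  also have "\<dots> \<le> branch k * wt k" using assms by (intro mult_right_mono) (auto simp: less_imp_le)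
  finally show ?thesis using assms by (simp add: start_eq)
qed

lemma start_growth:
  "29/25 * start 2 \<le> start 3" "5/4 * start 2 \<le> start 4" "43/40 * start 3 \<le> start 4"
  "28/25 * start 3 \<le> start 5" "101/100 * start 4 \<le> start 5"
proof -
  show "29/25 * start 2 \<le> start 3"
    by (rule start_ratio[where c = "0.8545" and a = "14659/10000" and b = "10746/10000"])
      (use branch_lower wt_3_bounds rho_bounds in \<open>simp_all add: wt_2\<close>)
  show "5/4 * start 2 \<le> start 4"
    by (rule start_ratio[where c = "0.727" and a = "1861/1000" and b = "10746/10000"])
      (use branch_lower branch_pos[of 2] wt_4_bounds rho_bounds in \<open>simp_all add: wt_2\<close>)
  show "43/40 * start 3 \<le> start 4"
    by (rule start_ratio[where c = "0.8515" and a = "1861/1000" and b = "14661/10000"])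
      (use branch_lower wt_4_bounds wt_3_bounds in simp_all)
  show "28/25 * start 3 \<le> start 5"
    by (rule start_ratio[where c = "0.738" and a = "2253/1000" and b = "14661/10000"])
      (use branch_lower branch_pos[of 3] wt_5_bounds wt_3_bounds in simp_all)
  show "101/100 * start 4 \<le> start 5"
    by (rule start_ratio[where c = "0.867" and a = "2253/1000" and b = "1862/1000"])
      (use branch_lower wt_5_bounds wt_4_bounds in simp_all)
qed

section \<open>Neighbours along parallel edges\<close>

text \<open>A neighbour with no more than \<open>m\<close> edges besides the \<open>m\<close> edges to the current end is represented by the
  point for \<open>m\<close>, because this case is tightest when the current end has no other neighbour. From \<open>j = 5\<close> on the weight of the parallel edges alone suffices; below, the
  growth of \<open>start\<close> from \<open>j\<close> to \<open>m\<close> helps.\<close>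

lemma mult_start_le:
  assumes "2 \<le> j" "j \<le> m"
  shows "real m * start j \<le> start m * (wt (j + m) * rho ^ (m - 1))"
proof -
  define W where "W = (\<lambda>i. wt (i + m) * rho ^ (m - 1))"
  have W0: "0 \<le> W i" for i using rho_pos by (simp add: W_def less_imp_le)
  \<comment> \<open>A deficit \<open>c\<close> of the weight is compensated by the growth of \<open>start\<close>.\<close>
  have main: "real m * start j \<le> start m * W j" if "real m \<le> c * W j" "c * start j \<le> start m" "0 \<le> c" for c
  proof -
    have "real m * start j \<le> (c * start j) * W j"
      using mult_right_mono[OF that(1) start_nonneg[of j]] by (simp add: mult_ac)
    also have "\<dots> \<le> start m * W j" using that(2) W0 by (rule mult_right_mono)
    finally show ?thesis .
  qed
  have up: "c * start j \<le> start m" if "c * start j \<le> start k" "k \<le> m" for c k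
    using that start_mono[of k m] by linarith
  consider "j = 2" | "j = 3" | "j = 4" | "j \<ge> 5" using assms by linarith
  then have "real m * start j \<le> start m * W j"
  proof cases
    case 1
    consider "m = 2" | "m = 3" | "m \<ge> 4" using assms by linarith
    then show ?thesis
    proof cases
      case 3
      show ?thesis
        by (rule main[where c = "5/4"])
          (use 1 3 le_wt_rho_power_2[of m] up[of "5/4" 4] start_growth in
            \<open>simp_all add: W_def add.commute\<close>)
    qed (use 1 main[of "1"] main[of "29/25"] le_wt_rho_power_small start_growth in \<open>simp_all add: W_def\<close>)
  next
    case 2
    consider "m = 3" | "m = 4" | "m \<ge> 5" using assms 2 by linarith
    then show ?thesis
    proof cases
      case 3
      show ?thesis
        by (rule main[where c = "28/25"])
          (use 2 3 le_wt_rho_power_3[of m] up[of "28/25" 5] start_growth in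
            \<open>simp_all add: W_def add.commute\<close>)
    qed (use 2 main[of "1"] main[of "43/40"] le_wt_rho_power_small start_growth in \<open>simp_all add: W_def\<close>)
  next
    case 3
    consider "m = 4" | "m \<ge> 5" using assms 3 by linarith
    then show ?thesis
    proof cases
      case 2
      show ?thesis
        by (rule main[where c = "101/100"])
          (use 2 3 le_wt_rho_power_4[of m] up[of "101/100" 5] start_growth in
            \<open>simp_all add: W_def add.commute\<close>)
    qed (use 3 main[of "1"] le_wt_rho_power_small start_growth in \<open>simp_all add: W_def\<close>)
  next
    case 4
    have "real m \<le> 1 * W 5" using le_wt_rho_power_5[of m] assms 4 by (simp add: W_def add.commute)
    also have "\<dots> \<le> 1 * W j" unfolding W_def using 4 rho_pos
      by (intro mult_left_mono mult_right_mono wt_mono) auto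
    finally show ?thesis by (rule main) (use start_mono[OF assms(2)] in auto)
  qed
  then show ?thesis by (simp add: W_def)
qed

text \<open>As \<open>gap\<close> decreases, \<open>step\<close> falls at most linearly from \<open>j\<close> on.\<close>

lemma ln_wt_lower:
  assumes "2 \<le> j"
  shows "real i * step j - gap j * (real i * (real i - 1) / 2) \<le> ln (wt (j + i)) - ln (wt j)"
    and "step j - real i * gap j \<le> step (j + i)"
proof -
  have gap: "gap (j + i) \<le> gap j" for i
  proof (induction i)
    case (Suc i) then show ?case using gap_antimono_Suc[of "j + i"] assms by simp
  qed simp
  show step: "step j - real i * gap j \<le> step (j + i)" for i
  proof (induction i)
    case (Suc i)
    have "step (j + Suc i) = step (j + i) - gap (j + i)" by (simp add: gap_def)
    then show ?case using Suc gap[of i] by (simp add: algebra_simps)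
  qed simp
  show "real i * step j - gap j * (real i * (real i - 1) / 2) \<le> ln (wt (j + i)) - ln (wt j)"
  proof (induction i)
    case (Suc i)
    have "ln (wt (j + Suc i)) = ln (wt (j + i)) + step (j + i)" by (simp add: step_def)
    then show ?case using Suc step[of i] by (simp add: field_simps)
  qed simp
qed

text \<open>If \<open>m \<le> j\<close>, then \<open>m\<close> parallel edges compare with \<open>m\<close> single edges of type \<open>j\<close>. The degree drops by
  \<open>m\<close> at once, which gains less than \<open>m\<close> separate drops from \<open>j + 1\<close> to \<open>j\<close>; the difference is at most
  \<open>gap j * m (m - 1) / 2\<close>, and the \<open>m - 1\<close> factors \<open>\<rho>\<close> cover it because \<open>m * gap j \<le> 2 ln \<rho>\<close>.\<close>

lemma wt_le_admissible:
  assumes "1 \<le> m" "m \<le> j" "2 \<le> j"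
  shows "wt j \<le> wt (j + m) * rho ^ (m - 1) * exp (- (real m * step j))"
proof -
  have "gap j * (real m * (real m - 1) / 2) = (real m * gap j) * ((real m - 1) / 2)" by simp
  also have "\<dots> \<le> (real j * gap j) * ((real m - 1) / 2)"
    using assms gap_pos[of j] by (intro mult_right_mono) auto
  also have "\<dots> \<le> (2 * ln rho) * ((real m - 1) / 2)"
    using mult_gap_le[of j] assms by (intro mult_right_mono) auto
  also have "\<dots> = real (m - 1) * ln rho" using assms by (simp add: of_nat_diff)
  finally have "ln (wt j) \<le> ln (wt (j + m)) + real (m - 1) * ln rho - real m * step j"
    using ln_wt_lower(1)[OF assms(3), of m] by linarith
  then have "exp (ln (wt j)) \<le> exp (ln (wt (j + m)) + real (m - 1) * ln rho - real m * step j)"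
    by (simp only: exp_le_cancel_iff)
  also have "\<dots> = wt (j + m) * rho ^ (m - 1) * exp (- (real m * step j))"
    using rho_pos exp_of_nat_mult[of "m - 1" "ln rho"]
    by (simp only: exp_diff exp_add exp_ln wt_pos) (simp add: exp_minus divide_inverse)
  finally show ?thesis by simp
qed

text \<open>A double edge to a vertex of degree 3 has \<open>j = 1\<close>, while the points are only used from \<open>j = 2\<close> on, and the point for
  \<open>m = 2\<close> is too far to the right. The point for 4 works.\<close>

lemma branch_4_double_edge:
  "1 \<le> wt 3 * rho * exp (- (2 * step 4))" "1 \<le> branch 4 * (wt 3 * rho * exp (- (2 * step 4)))"
proof -
  have "exp (step 4) = wt 5 / wt 4" using exp_step[of 4] by simp
  also have "\<dots> \<le> (2254/1000) / (1861/1000)" using wt_5_bounds wt_4_bounds by (intro frac_le) auto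
  finally have "exp (step 4) ^ 2 \<le> ((2254/1000) / (1861/1000)) ^ 2" by (intro power_mono) auto
  then have e: "exp (2 * step 4) \<le> 1.47" by (simp add: exp_double power_divide)
  have "14659/10000 * (10745/10000) \<le> wt 3 * rho" using wt_3_bounds rho_bounds by (intro mult_mono) auto
  then have w: "1.57 \<le> wt 3 * rho" by simp
  have "14659/10000 / (10746/10000) \<le> wt 3 / wt 2" using wt_3_bounds rho_bounds rho_pos
    by (intro frac_le) (auto simp: wt_2)
  then have "1.364 \<le> branch 2" using exp_step[of 2] by (simp add: branch_2)
  then have b: "0.99 \<le> branch 4" using branch_lower by simp
  have "0.99 * 1.57 \<le> branch 4 * (wt 3 * rho)" using b w by (intro mult_mono) auto
  then have "exp (2 * step 4) \<le> branch 4 * (wt 3 * rho)" using e by simp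
  then show "1 \<le> branch 4 * (wt 3 * rho * exp (- (2 * step 4)))"
    by (simp add: exp_minus field_simps)
  have "exp (2 * step 4) \<le> wt 3 * rho" using e w by simp
  then show "1 \<le> wt 3 * rho * exp (- (2 * step 4))"
    by (simp add: exp_minus field_simps)
qed

text \<open>A neighbour of degree \<open>D\<close> joined by \<open>m\<close> edges is no worse than \<open>m\<close> single edges represented by
  one admissible point. The two inequalities say so for paths that avoid the neighbour and for paths that go to it.\<close>

lemma neighbour_admissible:
  assumes "3 \<le> D" "1 \<le> m" "m \<le> D"
  obtains l y where "admissible l y"
    and "wt (D - m) \<le> wt D * rho ^ (m - 1) * exp (- (real m * l))"
    and "start (D - m) \<le> y * (wt D * rho ^ (m - 1) * exp (- (real m * l)))"
proof -
  define j where "j = D - m"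
  have D: "D = j + m" using assms by (simp add: j_def)
  define W where "W = wt D * rho ^ (m - 1)"
  have W1: "1 \<le> W" unfolding W_def using wt_ge1[of D] rho_gt1
    by (metis mult_mono' mult_1 one_le_power less_imp_le zero_le_one)
  have "\<exists>l y. admissible l y \<and> wt j \<le> W * exp (- (real m * l)) \<and>
      start j \<le> y * (W * exp (- (real m * l)))"
  proof -
    consider "j = 0" | "j = 1" "m = 2" | "j = 1" "m \<ge> 3" | "2 \<le> j" "m \<le> j" | "2 \<le> j" "j \<le> m"
      using assms D by linarith
    then show ?thesis
    proof cases
      case 1
      then show ?thesis using admissible_0 W1 by (intro exI[of _ 0]) (auto simp: start_def)
    next
      case 2
      show ?thesis
        by (rule exI[of _ "step 4"], rule exI[of _ "branch 4"])
          (use 2 admissible_step[of 4] branch_pos[of 4] branch_4_double_edge in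
            \<open>auto simp: W_def D start_def numeral_3_eq_3 less_imp_le\<close>)
    next
      case 3
      have "real m \<le> real 13 / real 9 * W"
        using le_wt_rho_power_1[of m] 3 by (simp add: W_def D)
      also have "\<dots> \<le> wt 3 * W" using wt_3_bounds W1 by (intro mult_right_mono) auto
      finally have le: "real m \<le> wt 3 * W" .
      have e: "exp (- (real m * step m)) = wt m / real m" using exp_mult_step[of m] 3 by simp
      have "wt 3 * W \<le> wt m * W" using wt_mono[of 3 m] 3 W1 by (intro mult_right_mono) auto
      moreover have "wt 3 * W \<le> start m * W" using start_mono[of 2 m] start_2 3 W1
        by (intro mult_right_mono) auto
      ultimately have "real m \<le> wt m * W" "real m \<le> start m * W" using le by linarith+
      then show ?thesis
        by - (rule exI[of _ "step m"], rule exI[of _ "branch m"], unfold e,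
          use 3 admissible_step[of m] branch_pos[of m] in
          \<open>auto simp: start_def field_simps less_imp_le\<close>)
    next
      case 4
      then have "wt j \<le> W * exp (- (real m * step j))"
        using wt_le_admissible[of m j] assms by (simp add: W_def D)
      then show ?thesis
        by - (rule exI[of _ "step j"], rule exI[of _ "branch j"],
          use 4 admissible_step[of j] branch_pos[of j] in \<open>auto simp: start_eq\<close>)
    next
      case 5
      have m: "2 \<le> m" using 5 by simp
      have e: "exp (- (real m * step m)) = wt m / real m" using exp_mult_step[of m] m by simp
      have s: "real m * start j \<le> start m * W" using mult_start_le[OF 5] by (simp add: W_def D)
      have "branch j * (real m * wt j) \<le> branch m * wt m * W"
        using s 5 m by (simp add: start_eq mult_ac)
      also have "\<dots> \<le> branch j * wt m * W"
        using branch_antimono[OF 5] W1 by (intro mult_right_mono) (auto simp: less_imp_le)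
      finally have "real m * wt j \<le> wt m * W" using branch_pos[of j] 5 by (simp add: mult.assoc)
      then show ?thesis
        by - (rule exI[of _ "step m"], rule exI[of _ "branch m"], unfold e,
          use s 5 m admissible_step[of m] branch_pos[of m] in
          \<open>auto simp: start_eq[OF m] field_simps less_imp_le\<close>)
    qed
  qed
  then show ?thesis using that unfolding W_def j_def by blast
qed

section \<open>Paths in multigraphs\<close>

text \<open>The number of paths from \<open>s\<close> to \<open>t\<close> in \<open>V\<close> with at most \<open>n\<close> edges, where \<open>\<mu> x y\<close> is the number of parallel edges
  between \<open>x\<close> and \<open>y\<close>. Bounding the length makes the recursion primitive; the bound on the number of paths does not
  depend on it.\<close>

primrec num_paths :: "nat \<Rightarrow> ('a \<Rightarrow> 'a \<Rightarrow> nat) \<Rightarrow> 'a set \<Rightarrow> 'a \<Rightarrow> 'a \<Rightarrow> nat" where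
  "num_paths 0 \<mu> V s t = (if s = t then 1 else 0)"
| "num_paths (Suc n) \<mu> V s t =
    (if s = t then 1 else (\<Sum>u\<in>V-{s}. \<mu> s u * num_paths n \<mu> (V - {s}) u t))"

definition deg :: "('a \<Rightarrow> 'a \<Rightarrow> nat) \<Rightarrow> 'a set \<Rightarrow> 'a \<Rightarrow> nat" where
  "deg \<mu> V v = (\<Sum>u\<in>V-{v}. \<mu> v u)"

text \<open>Every pair is counted in both orders, so a bundle of \<open>\<mu>\<close> parallel edges contributes \<open>2 (\<mu> - 1)\<close>. This is why
  \<open>weight\<close> has \<open>sqrt rho\<close>.\<close>

definition excess :: "('a \<Rightarrow> 'a \<Rightarrow> nat) \<Rightarrow> 'a set \<Rightarrow> nat" where
  "excess \<mu> V = (\<Sum>v\<in>V. \<Sum>u\<in>V-{v}. \<mu> v u - 1)"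

text \<open>Each walk \<open>x, w, y\<close> becomes a new edge from \<open>x\<close> to \<open>y\<close>. The loops created for \<open>x = y\<close> are ignored by
  \<open>num_paths\<close>, \<open>deg\<close> and \<open>excess\<close>.\<close>

definition suppress :: "('a \<Rightarrow> 'a \<Rightarrow> nat) \<Rightarrow> 'a \<Rightarrow> 'a \<Rightarrow> 'a \<Rightarrow> nat" where
  "suppress \<mu> w x y = \<mu> x y + \<mu> x w * \<mu> w y"

text \<open>The end \<open>t\<close> is treated as if it had one more edge. In the application this is the edge \<open>st\<close>, which
  is removed before paths are counted.\<close>

definition weight :: "('a \<Rightarrow> 'a \<Rightarrow> nat) \<Rightarrow> 'a set \<Rightarrow> 'a \<Rightarrow> 'a \<Rightarrow> real" where
  "weight \<mu> V s t = start (deg \<mu> V s) * wt (deg \<mu> V t + 1) *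
     (\<Prod>v\<in>V-{s,t}. wt (deg \<mu> V v)) * sqrt rho ^ excess \<mu> V"

lemma num_paths_refl [simp]: "num_paths n \<mu> V t t = 1"
  by (cases n) auto

lemma num_paths_mono_length: "num_paths n \<mu> V s t \<le> num_paths (Suc n) \<mu> V s t"
proof (induction n arbitrary: V s)
  case (Suc n)
  show ?case
  proof (cases "s = t")
    case False
    have "num_paths (Suc n) \<mu> V s t = (\<Sum>u\<in>V-{s}. \<mu> s u * num_paths n \<mu> (V - {s}) u t)"
      using False by simp
    also have "\<dots> \<le> (\<Sum>u\<in>V-{s}. \<mu> s u * num_paths (Suc n) \<mu> (V - {s}) u t)"
      by (intro sum_mono mult_left_mono Suc) simp
    also have "\<dots> = num_paths (Suc (Suc n)) \<mu> V s t"
      using False by (subst num_paths.simps(2)[of "Suc n"]) simp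
    finally show ?thesis .
  qed simp
qed auto

lemma num_paths_mono_mult:
  assumes "\<And>x y. \<mu> x y \<le> \<nu> x y"
  shows "num_paths n \<mu> V s t \<le> num_paths n \<nu> V s t"
proof (induction n arbitrary: V s)
  case (Suc n)
  then show ?case using assms by (auto intro!: sum_mono mult_mono)
qed auto

text \<open>A path through \<open>w\<close> is shortened to one of the new edges, and the shortening is injective.\<close>

lemma num_paths_suppress:
  assumes "finite V" "w \<noteq> s" "w \<noteq> t"
  shows "num_paths n \<mu> V s t \<le> num_paths n (suppress \<mu> w) (V - {w}) s t"
  using assms(1,2)
proof (induction n arbitrary: V s)
  case (Suc n)
  let ?P = "\<lambda>u. num_paths n (suppress \<mu> w) (V - {w} - {s}) u t"
  have V: "V - {s} - {w} = V - {w} - {s}" by auto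
  have le: "num_paths n \<mu> (V - {s}) u t \<le> ?P u" if "u \<noteq> w" for u
    using Suc.IH[of "V - {s}" u] Suc.prems that unfolding V by auto
  show ?case
  proof (cases "s = t")
    case False
    have "(\<Sum>u\<in>V-{s}. \<mu> s u * num_paths n \<mu> (V - {s}) u t) \<le>
        (\<Sum>u\<in>V-{w}-{s}. \<mu> s u * ?P u) + \<mu> s w * (\<Sum>y\<in>V-{w}-{s}. \<mu> w y * ?P y)"
    proof (cases "w \<in> V")
      case True
      have "num_paths n \<mu> (V - {s}) w t \<le> num_paths (Suc n) \<mu> (V - {s}) w t"
        by (rule num_paths_mono_length)
      also have "\<dots> = (\<Sum>y\<in>V-{w}-{s}. \<mu> w y * num_paths n \<mu> (V - {w} - {s}) y t)"
        using assms(3) by (simp add: V)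
      also have "\<dots> \<le> (\<Sum>y\<in>V-{w}-{s}. \<mu> w y * ?P y)"
        by (intro sum_mono mult_left_mono num_paths_mono_mult) (auto simp: suppress_def)
      finally have "\<mu> s w * num_paths n \<mu> (V - {s}) w t \<le> \<mu> s w * (\<Sum>y\<in>V-{w}-{s}. \<mu> w y * ?P y)"
        by (rule mult_left_mono) simp
      moreover have "(\<Sum>u\<in>V-{w}-{s}. \<mu> s u * num_paths n \<mu> (V - {s}) u t) \<le> (\<Sum>u\<in>V-{w}-{s}. \<mu> s u * ?P u)"
        using le by (intro sum_mono mult_left_mono) auto
      moreover have "(\<Sum>u\<in>V-{s}. \<mu> s u * num_paths n \<mu> (V - {s}) u t) =
          \<mu> s w * num_paths n \<mu> (V - {s}) w t + (\<Sum>u\<in>V-{w}-{s}. \<mu> s u * num_paths n \<mu> (V - {s}) u t)"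
        using True Suc.prems by (subst sum.remove[of _ w]) (auto simp: V)
      ultimately show ?thesis by linarith
    next
      case False
      then have "V - {s} = V - {w} - {s}" by auto
      moreover have "(\<Sum>u\<in>V-{w}-{s}. \<mu> s u * num_paths n \<mu> (V - {s}) u t) \<le> (\<Sum>u\<in>V-{w}-{s}. \<mu> s u * ?P u)"
        using le by (intro sum_mono mult_left_mono) auto
      ultimately have "(\<Sum>u\<in>V-{s}. \<mu> s u * num_paths n \<mu> (V - {s}) u t) \<le> (\<Sum>u\<in>V-{w}-{s}. \<mu> s u * ?P u)"
        by metis
      then show ?thesis by linarith
    qed
    also have "\<dots> = (\<Sum>u\<in>V-{w}-{s}. suppress \<mu> w s u * ?P u)"
      by (simp add: suppress_def sum_distrib_left sum.distrib algebra_simps)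
    finally show ?thesis using False by simp
  qed simp
qed simp

lemma num_paths_isolated:
  assumes "finite V" "t \<in> V" "u \<in> V" "u \<noteq> t" "deg \<mu> V t = 0" "\<And>x y. \<mu> x y = \<mu> y x"
  shows "num_paths n \<mu> V u t = 0"
  using assms(1-5)
proof (induction n arbitrary: V u)
  case (Suc n)
  have z: "\<mu> t x = 0" if "x \<in> V" "x \<noteq> t" for x
    using Suc.prems that by (auto simp: deg_def)
  have "deg \<mu> (V - {u}) t = 0" using z by (auto simp: deg_def)
  then have "\<mu> u x * num_paths n \<mu> (V - {u}) x t = 0" if "x \<in> V - {u}" for x
    using that Suc.IH[of "V - {u}" x] Suc.prems z[of u] assms(6)[of u t] by (cases "x = t") auto
  then show ?case using Suc.prems by simp
qed simp

lemma deg_remove: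
  assumes "finite V" "w \<in> V" "v \<noteq> w"
  shows "deg \<mu> V v = \<mu> v w + deg \<mu> (V - {w}) v"
proof -
  have "V - {v} - {w} = V - {w} - {v}" by auto
  then show ?thesis using assms unfolding deg_def by (subst sum.remove[of _ w]) auto
qed

text \<open>A neighbour \<open>v\<close> of \<open>w\<close> exchanges its edges to \<open>w\<close> for at most as many new ones, since \<open>w\<close> has at most one
  edge that does not go to \<open>v\<close>.\<close>

lemma deg_suppress:
  assumes "finite V" "w \<in> V" "v \<in> V" "v \<noteq> w" "deg \<mu> V w \<le> 2" "\<And>x y. \<mu> x y = \<mu> y x"
  shows "deg (suppress \<mu> w) (V - {w}) v \<le> deg \<mu> V v"
proof -
  define r where "r = (\<Sum>u\<in>V-{w}-{v}. \<mu> w u)"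
  have r: "deg \<mu> V w = \<mu> v w + r"
    unfolding deg_def r_def using assms by (subst sum.remove[of _ v]) auto
  have "\<mu> v w = 0 \<or> r \<le> 1" using r assms(5) by linarith
  then have "\<mu> v w * r \<le> \<mu> v w" by auto
  moreover have "deg (suppress \<mu> w) (V - {w}) v = deg \<mu> (V - {w}) v + \<mu> v w * r"
    by (simp add: deg_def suppress_def r_def sum.distrib sum_distrib_left)
  ultimately show ?thesis using deg_remove[OF assms(1,2,4)] by simp
qed

text \<open>If \<open>w\<close> has two neighbours of multiplicity 1, then one edge is created and the excess can grow by 2, once
  for each order of its ends. Otherwise no edge between distinct vertices is created.\<close>

lemma excess_suppress:
  assumes "finite V" "w \<in> V" "deg \<mu> V w \<le> 2" "\<And>x y. \<mu> x y = \<mu> y x"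
  shows "excess (suppress \<mu> w) (V - {w}) \<le> excess \<mu> V + (if deg \<mu> V w = 2 then 2 else 0)"
proof -
  let ?U = "V - {w}"
  have "excess (suppress \<mu> w) ?U \<le> (\<Sum>v\<in>?U. \<Sum>u\<in>?U-{v}. (\<mu> v u - 1) + \<mu> v w * \<mu> w u)"
    unfolding excess_def suppress_def by (intro sum_mono) simp
  also have "\<dots> = (\<Sum>v\<in>?U. \<Sum>u\<in>?U-{v}. \<mu> v u - 1) + (\<Sum>v\<in>?U. \<mu> w v * (\<Sum>u\<in>?U-{v}. \<mu> w u))"
    using assms(4)[of _ w] by (simp add: sum.distrib sum_distrib_left)
  also have "(\<Sum>v\<in>?U. \<Sum>u\<in>?U-{v}. \<mu> v u - 1) \<le> excess \<mu> V"
    unfolding excess_def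
    by (rule order_trans[OF sum_mono[OF sum_mono2] sum_mono2]) (use assms(1) in auto)
  also have "(\<Sum>v\<in>?U. \<mu> w v * (\<Sum>u\<in>?U-{v}. \<mu> w u)) \<le>
      (\<Sum>v\<in>?U. if deg \<mu> V w = 2 then \<mu> w v else 0)"
  proof (intro sum_mono)
    fix v assume v: "v \<in> ?U"
    define r where "r = (\<Sum>u\<in>?U-{v}. \<mu> w u)"
    have "deg \<mu> V w = \<mu> w v + r"
      unfolding deg_def r_def using assms v by (subst sum.remove[of _ v]) auto
    then have "(\<mu> w v = 0 \<or> r = 0) \<or> (\<mu> w v = 1 \<and> r = 1 \<and> deg \<mu> V w = 2)"
      using assms(3) by linarith
    then show "\<mu> w v * r \<le> (if deg \<mu> V w = 2 then \<mu> w v else 0)" by auto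
  qed
  also have "\<dots> = (if deg \<mu> V w = 2 then 2 else 0)" by (auto simp: deg_def)
  finally show ?thesis by simp
qed

lemma sqrt_rho: "sqrt rho ^ 2 = rho" "1 \<le> sqrt rho" "0 < sqrt rho"
  using rho_gt1 by auto

text \<open>The factor \<open>wt 2 = rho\<close> of a suppressed vertex of degree 2 pays for the growth of the excess.\<close>

lemma weight_suppress:
  assumes V: "finite V" "s \<in> V" "t \<in> V" and w: "w \<in> V - {s, t}" "deg \<mu> V w \<le> 2"
    and sym: "\<And>x y. \<mu> x y = \<mu> y x"
  shows "weight (suppress \<mu> w) (V - {w}) s t \<le> weight \<mu> V s t"
proof -
  let ?d = "deg (suppress \<mu> w) (V - {w})" and ?e = "excess (suppress \<mu> w) (V - {w})"
  have d: "?d v \<le> deg \<mu> V v" if "v \<in> V" "v \<noteq> w" for v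
    using deg_suppress V w sym that by (metis Diff_iff)
  have e: "sqrt rho ^ ?e \<le> wt (deg \<mu> V w) * sqrt rho ^ excess \<mu> V"
  proof -
    have "sqrt rho ^ ?e \<le> sqrt rho ^ (excess \<mu> V + (if deg \<mu> V w = 2 then 2 else 0))"
      using excess_suppress[of V w \<mu>] V w sym sqrt_rho by (intro power_increasing) auto
    also have "\<dots> \<le> wt (deg \<mu> V w) * sqrt rho ^ excess \<mu> V"
      using wt_ge1[of "deg \<mu> V w"] sqrt_rho rho_pos mult_right_mono[of 1 "wt (deg \<mu> V w)" "sqrt rho ^ excess \<mu> V"]
      by (auto simp: power_add wt_2)
    finally show ?thesis .
  qed
  have prod: "(\<Prod>v\<in>V-{s,t}. wt (deg \<mu> V v)) = wt (deg \<mu> V w) * (\<Prod>v\<in>V-{w}-{s,t}. wt (deg \<mu> V v))"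
  proof -
    have "V - {s,t} - {w} = V - {w} - {s,t}" by auto
    then show ?thesis using V w by (subst prod.remove[of _ w]) auto
  qed
  have "weight (suppress \<mu> w) (V - {w}) s t \<le>
      start (deg \<mu> V s) * wt (deg \<mu> V t + 1) * (\<Prod>v\<in>V-{w}-{s,t}. wt (deg \<mu> V v)) *
        (wt (deg \<mu> V w) * sqrt rho ^ excess \<mu> V)"
    unfolding weight_def using d V w
    by (intro mult_mono prod_mono e start_mono wt_mono conjI mult_nonneg_nonneg prod_nonneg start_nonneg)
      (auto intro: less_imp_le simp: less_imp_le[OF rho_pos])
  also have "\<dots> = weight \<mu> V s t" unfolding weight_def prod by (simp only: mult_ac)
  finally show ?thesis .
qed

lemma excess_remove:
  assumes "finite V" "s \<in> V" "\<And>x y. \<mu> x y = \<mu> y x"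
  shows "excess \<mu> V = excess \<mu> (V - {s}) + 2 * (\<Sum>v\<in>V-{s}. \<mu> s v - 1)"
proof -
  have "(\<Sum>u\<in>V-{v}. \<mu> v u - 1) = (\<mu> s v - 1) + (\<Sum>u\<in>V-{s}-{v}. \<mu> v u - 1)" if "v \<in> V - {s}" for v
  proof -
    have "V - {v} - {s} = V - {s} - {v}" by auto
    then show ?thesis using assms(1,2) assms(3)[of v s] that by (subst sum.remove[of _ s]) auto
  qed
  then have "(\<Sum>v\<in>V-{s}. \<Sum>u\<in>V-{v}. \<mu> v u - 1) = (\<Sum>v\<in>V-{s}. \<mu> s v - 1) + excess \<mu> (V - {s})"
    by (simp add: excess_def sum.distrib)
  moreover have "excess \<mu> V = (\<Sum>u\<in>V-{s}. \<mu> s u - 1) + (\<Sum>v\<in>V-{s}. \<Sum>u\<in>V-{v}. \<mu> v u - 1)"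
    unfolding excess_def using assms(1,2) by (rule sum.remove)
  ultimately show ?thesis by simp
qed

lemma weight_eq:
  assumes "finite V" "s \<in> V" "t \<in> V" "s \<noteq> t"
  shows "weight \<mu> V s t = start (deg \<mu> V s) *
    (\<Prod>v\<in>V-{s}. wt (deg \<mu> V v + (if v = t then 1 else 0))) * sqrt rho ^ excess \<mu> V"
proof -
  have "V - {s} - {t} = V - {s,t}" by auto
  then have "(\<Prod>v\<in>V-{s}. wt (deg \<mu> V v + (if v = t then 1 else 0))) =
      wt (deg \<mu> V t + 1) * (\<Prod>v\<in>V-{s,t}. wt (deg \<mu> V v))"
    using assms by (subst prod.remove[of _ t]) (auto intro!: prod.cong)
  then show ?thesis by (simp add: weight_def)
qed

lemma weight_ge_1:
  assumes "1 \<le> deg \<mu> V s"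
  shows "1 \<le> weight \<mu> V s t"
proof -
  have "1 * 1 * 1 * 1 \<le> weight \<mu> V s t"
    unfolding weight_def using start_ge1[OF assms] start_nonneg sqrt_rho
    by (intro mult_mono prod_ge_1 wt_ge1 one_le_power mult_nonneg_nonneg prod_nonneg)
      (auto intro: less_imp_le)
  then show ?thesis by simp
qed

text \<open>Branching over the vertex after \<open>s\<close>. Written with \<open>D v\<close>, which gives \<open>t\<close> its additional edge, all
  neighbours of \<open>s\<close> obey the same estimate \<open>sub\<close>; for \<open>t\<close> itself it holds because all weights are at least 1.
  Dividing by the weights \<open>W v\<close> leads to \<open>start_branching\<close>. It requires two edges at \<open>s\<close> and
  neighbours with \<open>D v \<ge> 3\<close>. The exceptions are a single edge at \<open>s\<close>, where the move is forced, and an end \<open>t\<close>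
  whose only edge goes to \<open>s\<close>, where there is only one path.\<close>

lemma num_paths_le_weight_expand:
  assumes V: "finite V" "s \<in> V" "t \<in> V" "s \<noteq> t" and sym: "\<And>x y. \<mu> x y = \<mu> y x"
    and big: "\<And>v. v \<in> V - {s, t} \<Longrightarrow> 3 \<le> deg \<mu> V v"
    and IH: "\<And>u. u \<in> V - {s, t} \<Longrightarrow> real (num_paths n \<mu> (V - {s}) u t) \<le> weight \<mu> (V - {s}) u t"
  shows "real (num_paths (Suc n) \<mu> V s t) \<le> weight \<mu> V s t"
proof -
  define N where "N = V - {s}"
  define m where "m = \<mu> s"
  define D where "D v = deg \<mu> V v + (if v = t then 1 else 0)" for v
  define W where "W v = wt (D v) * rho ^ (m v - 1)" for v
  define E where "E = sqrt rho ^ excess \<mu> N"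
  define k where "k = deg \<mu> V s"
  have N: "finite N" "t \<in> N" using V by (auto simp: N_def)
  have km: "(\<Sum>v\<in>N. m v) = k" by (simp add: k_def m_def N_def deg_def)
  have E1: "1 \<le> E" using sqrt_rho by (simp add: E_def)
  have Wpos: "W v > 0" for v using rho_pos by (simp add: W_def)
  have degN: "deg \<mu> V v = m v + deg \<mu> N v" if "v \<in> N" for v
    using deg_remove[of V s v \<mu>] V sym[of v s] that by (auto simp: N_def m_def)
  have degN': "deg \<mu> N v + (if v = t then 1 else 0) = D v - m v" "m v \<le> D v" if "v \<in> N" for v
    using degN[OF that] by (auto simp: D_def)
  have sub: "real (num_paths n \<mu> N u t) \<le> start (D u - m u) * (\<Prod>v\<in>N-{u}. wt (D v - m v)) * E"
    if u: "u \<in> N" for u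
  proof (cases "u = t")
    case True
    have "1 \<le> start (D t - m t)" using degN[OF N(2)] by (intro start_ge1) (simp add: D_def)
    then have "1 * 1 * 1 \<le> start (D t - m t) * (\<Prod>v\<in>N-{t}. wt (D v - m v)) * E"
      using E1 start_nonneg by (intro mult_mono prod_ge_1 wt_ge1 mult_nonneg_nonneg prod_nonneg)
        (auto intro: less_imp_le)
    then show ?thesis using True by simp
  next
    case False
    then have "real (num_paths n \<mu> N u t) \<le> weight \<mu> N u t" using IH[of u] u by (simp add: N_def)
    also have "\<dots> = start (deg \<mu> N u) * (\<Prod>v\<in>N-{u}. wt (deg \<mu> N v + (if v = t then 1 else 0))) * E"
      unfolding E_def by (rule weight_eq) (use N u False in auto)
    also have "(\<Prod>v\<in>N-{u}. wt (deg \<mu> N v + (if v = t then 1 else 0))) = (\<Prod>v\<in>N-{u}. wt (D v - m v))"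
      using degN' by (intro prod.cong) auto
    also have "deg \<mu> N u = D u - m u" using degN'[OF u] False by simp
    finally show ?thesis .
  qed
  have weight: "weight \<mu> V s t = start k * (\<Prod>v\<in>N. W v) * E"
  proof -
    have "sqrt rho ^ excess \<mu> V = E * (\<Prod>v\<in>N. rho ^ (m v - 1))"
      using excess_remove[OF V(1,2) sym]
      by (simp add: E_def N_def m_def power_add power_mult sqrt_rho flip: power_sum)
    then show ?thesis using weight_eq[OF V(1-4), of \<mu>]
      by (simp add: k_def W_def D_def N_def prod.distrib mult_ac)
  qed
  have expand: "num_paths (Suc n) \<mu> V s t = (\<Sum>u\<in>N. m u * num_paths n \<mu> N u t)"
    using V by (simp add: N_def m_def)
  show ?thesis
  proof (cases "m t = 1 \<and> D t = 2")
    case True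
    then have "deg \<mu> N t = 0" using degN[OF N(2)] by (simp add: D_def)
    \<comment> \<open>Once \<open>s\<close> is deleted, \<open>t\<close> is isolated, so all other branches are empty.\<close>
    then have "m u * num_paths n \<mu> N u t = (if u = t then 1 else 0)" if "u \<in> N" for u
      using that True num_paths_isolated[OF N that, of \<mu> n] sym by auto
    then have "num_paths (Suc n) \<mu> V s t = 1" unfolding expand using N by simp
    moreover have "1 \<le> k" using km True N member_le_sum[of t N m] by simp
    ultimately show ?thesis using weight_ge_1[of \<mu> V s t] by (simp add: k_def)
  next
    case False
    have D3: "3 \<le> D u" if "u \<in> N" "1 \<le> m u" for u
      using big[of u] that degN[OF that(1)] False by (cases "u = t") (auto simp: D_def N_def)
    consider "k = 0" | "k = 1" | "k \<ge> 2" by linarith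
    then show ?thesis
    proof cases
      case 1
      then have "m u = 0" if "u \<in> N" for u using km N that by auto
      then have "num_paths (Suc n) \<mu> V s t = 0" unfolding expand by simp
      moreover have "0 \<le> weight \<mu> V s t" using 1 weight by (simp add: start_def)
      ultimately show ?thesis by simp
    next
      case 2
      obtain u where u: "u \<in> N" "m u \<noteq> 0" using 2 km by (metis sum.neutral zero_neq_one)
      have "m u + (\<Sum>v\<in>N-{u}. m v) = 1" using km 2 sum.remove[OF N(1) u(1), of m] by simp
      then have mu: "m u = 1" and "(\<Sum>v\<in>N-{u}. m v) = 0" using u by auto
      then have m0: "m v = 0" if "v \<in> N - {u}" for v using that N by auto
      have "num_paths (Suc n) \<mu> V s t = num_paths n \<mu> N u t"
        unfolding expand sum.remove[OF N(1) u(1)] using mu m0 by simp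
      also have "real \<dots> \<le> start (D u - 1) * (\<Prod>v\<in>N-{u}. wt (D v)) * E"
        using sub[OF u(1)] mu m0 by simp
      also have "\<dots> \<le> wt (D u) * (\<Prod>v\<in>N-{u}. wt (D v)) * E"
        using D3[of u] u mu start_le_wt[of "D u - 1"] E1
        by (intro mult_right_mono prod_nonneg) (auto intro: less_imp_le)
      also have "\<dots> = (\<Prod>v\<in>N. W v) * E"
        unfolding prod.remove[OF N(1) u(1), of W] using mu m0 by (simp add: W_def)
      also have "\<dots> = weight \<mu> V s t" using 2 weight by (simp add: start_def)
      finally show ?thesis .
    next
      case 3
      have "\<exists>l y. admissible l y \<and>
          wt (D v - m v) / W v \<le> exp (- (real (m v) * l)) \<and>
          real (m v) * start (D v - m v) / W v \<le> real (m v) * y * exp (- (real (m v) * l))"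
        if v: "v \<in> N" for v
      proof (cases "m v = 0")
        case True
        then show ?thesis using admissible_0 by (intro exI[of _ 0]) (auto simp: W_def)
      next
        case False
        then obtain l y where "admissible l y"
          and le: "wt (D v - m v) \<le> W v * exp (- (real (m v) * l))"
            "start (D v - m v) \<le> y * (W v * exp (- (real (m v) * l)))"
          using neighbour_admissible[of "D v" "m v"] D3[OF v] degN'[OF v] unfolding W_def by (metis less_one not_less)
        moreover have "real (m v) * start (D v - m v) \<le> real (m v) * (y * (W v * exp (- (real (m v) * l))))"
          using le(2) by (rule mult_left_mono) simp
        ultimately show ?thesis using Wpos[of v]
          by (intro exI[of _ l] exI[of _ y]) (simp add: pos_divide_le_eq mult_ac)
      qed
      then obtain l y where ly: "\<And>v. v \<in> N \<Longrightarrow> admissible (l v) (y v)"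
          "\<And>v. v \<in> N \<Longrightarrow> wt (D v - m v) / W v \<le> exp (- (real (m v) * l v))"
          "\<And>v. v \<in> N \<Longrightarrow> real (m v) * start (D v - m v) / W v \<le> real (m v) * y v * exp (- (real (m v) * l v))"
        by metis
      have "real (num_paths (Suc n) \<mu> V s t) \<le>
          (\<Sum>u\<in>N. real (m u) * (start (D u - m u) * (\<Prod>v\<in>N-{u}. wt (D v - m v)) * E))"
        unfolding expand of_nat_sum of_nat_mult using sub by (intro sum_mono mult_left_mono) auto
      also have "\<dots> = (\<Sum>u\<in>N. (real (m u) * start (D u - m u) / W u) *
          (\<Prod>v\<in>N-{u}. wt (D v - m v) / W v)) * ((\<Prod>v\<in>N. W v) * E)"
        unfolding sum_distrib_right
      proof (intro sum.cong refl)
        fix u assume u: "u \<in> N"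
        have "(\<Prod>v\<in>N-{u}. W v) \<noteq> 0" using N Wpos by (simp add: less_imp_neq[symmetric])
        moreover have "(\<Prod>v\<in>N. W v) = W u * (\<Prod>v\<in>N-{u}. W v)" by (rule prod.remove[OF N(1) u])
        ultimately show "real (m u) * (start (D u - m u) * (\<Prod>v\<in>N-{u}. wt (D v - m v)) * E) =
          (real (m u) * start (D u - m u) / W u) *
          (\<Prod>v\<in>N-{u}. wt (D v - m v) / W v) * ((\<Prod>v\<in>N. W v) * E)"
          using Wpos[of u] by (simp add: prod_dividef)
      qed
      also have "\<dots> \<le> start k * ((\<Prod>v\<in>N. W v) * E)"
      proof (intro mult_right_mono start_branching[where m = m and l = l and y = y])
        show "0 \<le> (\<Prod>v\<in>N. W v) * E" using Wpos E1 by (intro mult_nonneg_nonneg prod_nonneg) (auto intro: less_imp_le)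
      qed (use N km 3 ly start_nonneg less_imp_le[OF Wpos] less_imp_le[OF wt_pos] in
          \<open>auto intro!: divide_nonneg_nonneg mult_nonneg_nonneg\<close>)
      finally show ?thesis by (simp add: weight mult.assoc)
    qed
  qed
qed

text \<open>Inner vertices of degree at most 2 are suppressed first, which does not increase the weight; when
  none is left, the paths are expanded at \<open>s\<close>.\<close>

theorem num_paths_le_weight:
  assumes "finite V" "s \<in> V" "t \<in> V" "s \<noteq> t" "\<And>x y. \<mu> x y = \<mu> y x"
  shows "real (num_paths n \<mu> V s t) \<le> weight \<mu> V s t"
  using assms
proof (induction "card V" arbitrary: V \<mu> s n rule: less_induct)
  case less
  have pos: "0 \<le> weight \<mu> V s t"
    using start_nonneg less_imp_le[OF wt_pos] less_imp_le[OF rho_pos]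
    by (auto simp: weight_def intro!: mult_nonneg_nonneg prod_nonneg)
  show ?case
  proof (cases "\<exists>w\<in>V-{s,t}. deg \<mu> V w \<le> 2")
    case True
    then obtain w where w: "w \<in> V - {s,t}" "deg \<mu> V w \<le> 2" by blast
    have "num_paths n \<mu> V s t \<le> num_paths n (suppress \<mu> w) (V - {w}) s t"
      using w less.prems by (intro num_paths_suppress) auto
    also have "real \<dots> \<le> weight (suppress \<mu> w) (V - {w}) s t"
      using w less.prems(1-4)
    proof (intro less.hyps)
      show "card (V - {w}) < card V" using w less.prems(1) by (intro psubset_card_mono) auto
      show "suppress \<mu> w x y = suppress \<mu> w y x" for x y
        using less.prems(5) by (simp add: suppress_def mult.commute)
    qed auto
    also have "\<dots> \<le> weight \<mu> V s t" by (rule weight_suppress) (use w less.prems in auto)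
    finally show ?thesis by simp
  next
    case False
    show ?thesis
    proof (cases n)
      case 0
      then show ?thesis using less.prems pos by simp
    next
      case (Suc n')
      show ?thesis unfolding Suc
      proof (rule num_paths_le_weight_expand)
        show "3 \<le> deg \<mu> V v" if "v \<in> V - {s, t}" for v
          by (rule ccontr) (use False that in force)
      next
        fix u assume u: "u \<in> V - {s, t}"
        show "real (num_paths n' \<mu> (V - {s}) u t) \<le> weight \<mu> (V - {s}) u t"
        proof (rule less.hyps)
          show "card (V - {s}) < card V" using less.prems by (intro psubset_card_mono) auto
        qed (use u less.prems in auto)
      qed (use less.prems in auto)
    qed
  qed
qed

section \<open>Cycles through an edge\<close>

fun path_edges :: "'a list \<Rightarrow> 'a set set" where
  "path_edges (x # y # xs) = insert {x, y} (path_edges (y # xs))"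
| "path_edges _ = {}"

text \<open>The edges of the cycle that closes up the path \<open>xs\<close>, in a form that makes rotation and reversal easy.\<close>

definition closed_edges :: "'a list \<Rightarrow> 'a set set" where
  "closed_edges xs = insert {last xs, hd xs} (path_edges xs)"

definition paths :: "'a set set \<Rightarrow> 'a set \<Rightarrow> 'a \<Rightarrow> 'a \<Rightarrow> 'a list set" where
  "paths F V s t = {xs. distinct xs \<and> set xs \<subseteq> V \<and> xs \<noteq> [] \<and> hd xs = s \<and> last xs = t \<and> path_edges xs \<subseteq> F}"

definition adjacency :: "'a set set \<Rightarrow> 'a \<Rightarrow> 'a \<Rightarrow> nat" where
  "adjacency F x y = (if {x, y} \<in> F then 1 else 0)"

lemma finite_paths: "finite V \<Longrightarrow> finite (paths F V s t)"
  by (rule finite_subset[OF _ finite_subset_distinct[of V]]) (auto simp: paths_def)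

lemma path_edges_Cons: "xs \<noteq> [] \<Longrightarrow> path_edges (x # xs) = insert {x, hd xs} (path_edges xs)"
  by (cases xs) auto

lemma path_edges_append:
  "xs \<noteq> [] \<Longrightarrow> ys \<noteq> [] \<Longrightarrow> path_edges (xs @ ys) = insert {last xs, hd ys} (path_edges xs \<union> path_edges ys)"
  by (induction xs rule: path_edges.induct) (auto simp: path_edges_Cons)

lemma path_edges_rev: "path_edges (rev xs) = path_edges xs"
proof (induction xs)
  case (Cons x xs)
  then show ?case
    by (cases "xs = []") (auto simp: path_edges_append path_edges_Cons last_rev insert_commute)
qed simp

lemma path_edges_nth: "path_edges xs = {{xs ! i, xs ! Suc i} | i. Suc i < length xs}"
proof (induction xs rule: path_edges.induct)
  case (1 x y xs)
  have "{{(x # y # xs) ! i, (x # y # xs) ! Suc i} | i. Suc i < length (x # y # xs)} =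
      insert {x, y} {{(y # xs) ! i, (y # xs) ! Suc i} | i. Suc i < length (y # xs)}"
    (is "?A = ?B")
  proof (intro equalityI subsetI)
    fix e assume "e \<in> ?A"
    then obtain i where i: "e = {(x # y # xs) ! i, (x # y # xs) ! Suc i}" "Suc i < length (x # y # xs)" by blast
    then show "e \<in> ?B" by (cases i) auto
  next
    fix e assume "e \<in> ?B"
    then consider "e = {x, y}" | i where "e = {(y # xs) ! i, (y # xs) ! Suc i}" "Suc i < length (y # xs)" by blast
    then show "e \<in> ?A"
    proof cases
      case 1
      then show ?thesis by (auto intro!: exI[of _ 0])
    next
      case (2 i)
      then show ?thesis by (auto intro!: exI[of _ "Suc i"])
    qed
  qed
  then show ?case using 1 by simp
qed auto

lemma card_paths_le: 
  assumes "finite V" "card V \<le> n"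
  shows "card (paths F V s t) \<le> num_paths n (adjacency F) V s t"
  using assms
proof (induction n arbitrary: V s)
  case 0
  then have "paths F V s t = {}" by (auto simp: paths_def)
  then show ?case by simp
next
  case (Suc n)
  show ?case
  proof (cases "s = t")
    case True
    have "paths F V s t \<subseteq> {[s]}"
    proof
      fix xs assume "xs \<in> paths F V s t"
      then obtain ys where ys: "xs = s # ys" "distinct xs" "last xs = s"
        using True by (cases xs) (auto simp: paths_def)
      then have "ys = []" by (cases "ys = []") auto
      then show "xs \<in> {[s]}" using ys by simp
    qed
    then have "card (paths F V s t) \<le> card {[s]}" by (intro card_mono) auto
    then show ?thesis using True by simp
  next
    case False
    show ?thesis
    proof (cases "s \<in> V")
      case s: True
      let ?I = "{u \<in> V - {s}. {s, u} \<in> F}"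
      let ?A = "\<lambda>u. (#) s ` paths F (V - {s}) u t"
      have "paths F V s t \<subseteq> (\<Union>u\<in>?I. ?A u)"
      proof
        fix xs assume xs: "xs \<in> paths F V s t"
        then obtain ys where ys: "xs = s # ys" by (cases xs) (auto simp: paths_def)
        have ne: "ys \<noteq> []" using xs ys False by (auto simp: paths_def)
        then have "hd ys \<in> ?I" "ys \<in> paths F (V - {s}) (hd ys) t"
          using xs ys hd_in_set[OF ne] by (auto simp: paths_def path_edges_Cons)
        then show "xs \<in> (\<Union>u\<in>?I. ?A u)" using ys by blast
      qed
      moreover have fin: "finite (paths F (V - {s}) u t)" for u
        using Suc.prems by (intro finite_paths) auto
      ultimately have "card (paths F V s t) \<le> card (\<Union>u\<in>?I. ?A u)"
        using Suc.prems by (intro card_mono) auto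
      also have "\<dots> \<le> (\<Sum>u\<in>?I. card (?A u))" using Suc.prems by (intro card_UN_le) auto
      also have "\<dots> \<le> (\<Sum>u\<in>?I. num_paths n (adjacency F) (V - {s}) u t)"
      proof (intro sum_mono)
        fix u
        have "card (?A u) \<le> card (paths F (V - {s}) u t)" by (rule card_image_le[OF fin])
        also have "\<dots> \<le> num_paths n (adjacency F) (V - {s}) u t"
          using Suc.prems s by (intro Suc.IH) auto
        finally show "card (?A u) \<le> num_paths n (adjacency F) (V - {s}) u t" .
      qed
      also have "\<dots> = (\<Sum>u\<in>V-{s}. adjacency F s u * num_paths n (adjacency F) (V - {s}) u t)"
        using Suc.prems by (intro sum.mono_neutral_cong_left) (auto simp: adjacency_def)
      finally show ?thesis using False by simp
    next
      case s: False
      then have "paths F V s t = {}" using hd_in_set by (fastforce simp: paths_def)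
      then show ?thesis by simp
    qed
  qed
qed

lemma closed_edges_nth:
  assumes "xs \<noteq> []"
  shows "closed_edges xs = {{xs ! i, xs ! (Suc i mod length xs)} | i. i < length xs}"
    (is "_ = ?R")
proof (intro equalityI subsetI)
  fix e assume "e \<in> closed_edges xs"
  then consider "e = {last xs, hd xs}" | i where "e = {xs ! i, xs ! Suc i}" "Suc i < length xs"
    unfolding closed_edges_def path_edges_nth by blast
  then show "e \<in> ?R"
  proof cases
    case 1
    then show ?thesis using assms
      by (auto intro!: exI[of _ "length xs - 1"] simp: last_conv_nth hd_conv_nth)
  next
    case (2 i)
    then show ?thesis by (auto intro!: exI[of _ i])
  qed
next
  fix e assume "e \<in> ?R"
  then obtain i where i: "e = {xs ! i, xs ! (Suc i mod length xs)}" "i < length xs" by blast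
  show "e \<in> closed_edges xs"
  proof (cases "Suc i < length xs")
    case True
    then show ?thesis using i unfolding closed_edges_def path_edges_nth by auto
  next
    case False
    then have "Suc i = length xs" using i by simp
    then have "e = {last xs, hd xs}" using i assms
      by (metis diff_Suc_1 hd_conv_nth last_conv_nth mod_self)
    then show ?thesis by (simp add: closed_edges_def)
  qed
qed

lemma closed_edges_swap: "closed_edges (xs @ ys) = closed_edges (ys @ xs)"
  by (cases "xs = []"; cases "ys = []") (simp_all add: closed_edges_def path_edges_append insert_commute Un_commute)

lemma closed_edges_rev: "closed_edges (rev xs) = closed_edges xs"
  by (cases "xs = []") (auto simp: closed_edges_def path_edges_rev last_rev hd_rev insert_commute)

lemma ends_notin_path_edges:
  assumes "distinct xs" "3 \<le> length xs"
  shows "{last xs, hd xs} \<notin> path_edges xs"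
proof
  assume "{last xs, hd xs} \<in> path_edges xs"
  then obtain i where i: "{last xs, hd xs} = {xs ! i, xs ! Suc i}" "Suc i < length xs"
    unfolding path_edges_nth by blast
  have ne: "xs \<noteq> []" using assms(2) by auto
  have "{xs ! (length xs - 1), xs ! 0} = {xs ! i, xs ! Suc i}"
    using i(1) ne by (simp add: last_conv_nth hd_conv_nth)
  then show False using i(2) assms ne
    by (auto simp: doubleton_eq_iff nth_eq_iff_index_eq)
qed

lemma cycle_starting_at_edge:
  assumes "is_cycle C" "{s, t} \<in> edges C"
  obtains xs where "distinct xs" "3 \<le> length xs" "hd xs = s" "last xs = t"
    "verts C = set xs" "edges C = closed_edges xs"
proof -
  obtain vs where vs: "distinct vs" "3 \<le> length vs" "verts C = set vs"
      and E: "edges C = {{vs ! i, vs ! (Suc i mod length vs)} | i. i < length vs}"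
    using assms(1) unfolding is_cycle_def by blast
  have "vs \<noteq> []" using vs(2) by auto
  then have vs4: "edges C = closed_edges vs" using E closed_edges_nth[of vs] by simp
  have "\<exists>ys. distinct ys \<and> length ys = length vs \<and> set ys = set vs \<and>
      closed_edges ys = closed_edges vs \<and> {last ys, hd ys} = {s, t}"
  proof (cases "{s, t} = {last vs, hd vs}")
    case True
    show ?thesis by (rule exI[of _ vs]) (simp add: vs(1) True)
  next
    case False
    then obtain i where i: "{s, t} = {vs ! i, vs ! Suc i}" "Suc i < length vs"
      using assms(2) unfolding vs4 closed_edges_def path_edges_nth by auto
    \<comment> \<open>Cut the cycle open at the edge \<open>st\<close>.\<close>
    define as where "as = take (Suc i) vs"
    define bs where "bs = List.drop (Suc i) vs"
    have ab: "vs = as @ bs" by (simp add: as_def bs_def)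
    have h: "last as = vs ! i" "hd bs = vs ! Suc i" "as \<noteq> []" "bs \<noteq> []"
      using i(2) by (auto simp: as_def bs_def take_Suc_conv_app_nth hd_drop_conv_nth)
    show ?thesis
    proof (intro exI conjI)
      show "distinct (bs @ as)" "length (bs @ as) = length vs" "set (bs @ as) = set vs"
        using vs(1) unfolding ab by auto
      show "closed_edges (bs @ as) = closed_edges vs" unfolding ab by (rule closed_edges_swap)
      show "{last (bs @ as), hd (bs @ as)} = {s, t}" using h i(1) by simp
    qed
  qed
  then obtain ys where ys: "distinct ys" "length ys = length vs" "set ys = set vs"
      "closed_edges ys = closed_edges vs" "{last ys, hd ys} = {s, t}" by blast
  have ne: "ys \<noteq> []" using ys(2) vs(2) by auto
  show ?thesis
  proof (cases "hd ys = s \<and> last ys = t")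
    case True
    then show ?thesis using that[of ys] ys vs vs4 by simp
  next
    case False
    then have "hd (rev ys) = s" "last (rev ys) = t"
      using ys(5) ne by (auto simp: doubleton_eq_iff hd_rev last_rev)
    then show ?thesis using that[of "rev ys"] ys vs vs4 by (simp add: closed_edges_rev)
  qed
qed

text \<open>Every cycle through \<open>st\<close> arises by closing up a path from \<open>s\<close> to \<open>t\<close> that does not use \<open>st\<close>.\<close>

lemma card_cycles_through_edge:
  assumes "finite (verts G)"
  shows "card {C. subgraph C G \<and> is_cycle C \<and> {s, t} \<in> edges C}
    \<le> card (paths (edges G - {{s, t}}) (verts G) s t)"
proof -
  let ?P = "paths (edges G - {{s, t}}) (verts G) s t"
  have "{C. subgraph C G \<and> is_cycle C \<and> {s, t} \<in> edges C} \<subseteq> (\<lambda>xs. (set xs, closed_edges xs)) ` ?P"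
  proof
    fix C assume "C \<in> {C. subgraph C G \<and> is_cycle C \<and> {s, t} \<in> edges C}"
    then have C: "subgraph C G" "is_cycle C" "{s, t} \<in> edges C" by auto
    obtain xs where xs: "distinct xs" "3 \<le> length xs" "hd xs = s" "last xs = t"
        "verts C = set xs" "edges C = closed_edges xs"
      using cycle_starting_at_edge[OF C(2,3)] .
    have "path_edges xs \<subseteq> edges G - {{s, t}}"
      using ends_notin_path_edges[OF xs(1,2)] C(1) xs
      by (auto simp: subgraph_def closed_edges_def insert_commute)
    then have "xs \<in> ?P" using xs C(1) by (auto simp: paths_def subgraph_def)
    moreover have "C = (set xs, closed_edges xs)"
      using xs(5,6) by (simp add: verts_def edges_def prod_eq_iff)
    ultimately show "C \<in> (\<lambda>xs. (set xs, closed_edges xs)) ` ?P" by blast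
  qed
  then have "card {C. subgraph C G \<and> is_cycle C \<and> {s, t} \<in> edges C} \<le>
      card ((\<lambda>xs. (set xs, closed_edges xs)) ` ?P)"
    using finite_paths[OF assms] by (intro card_mono) auto
  also have "\<dots> \<le> card ?P" by (rule card_image_le[OF finite_paths[OF assms]])
  finally show ?thesis .
qed

lemma deg_adjacency:
  assumes G: "finite_simple_graph G" and F: "F \<subseteq> edges G" and v: "v \<in> verts G"
  shows "deg (adjacency F) (verts G) v = card {e \<in> F. v \<in> e}"
proof -
  have "deg (adjacency F) (verts G) v = card {u \<in> verts G - {v}. {v, u} \<in> F}"
    using G sum.inter_filter[of "verts G - {v}" "\<lambda>_. 1 :: nat" "\<lambda>u. {v, u} \<in> F"]
    by (simp add: deg_def adjacency_def finite_simple_graph_def)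
  also have "\<dots> = card {e \<in> F. v \<in> e}"
  proof (rule bij_betw_same_card)
    show "bij_betw (\<lambda>u. {v, u}) {u \<in> verts G - {v}. {v, u} \<in> F} {e \<in> F. v \<in> e}"
      unfolding bij_betw_def
    proof (intro conjI equalityI subsetI)
      show "inj_on (\<lambda>u. {v, u}) {u \<in> verts G - {v}. {v, u} \<in> F}"
        by (auto simp: inj_on_def doubleton_eq_iff)
    next
      fix e assume e: "e \<in> {e \<in> F. v \<in> e}"
      then have "card e = 2" "e \<subseteq> verts G" using F G by (auto simp: finite_simple_graph_def)
      then obtain u where "e = {v, u}" "u \<noteq> v" using e by (auto simp: card_2_iff doubleton_eq_iff)
      then show "e \<in> (\<lambda>u. {v, u}) ` {u \<in> verts G - {v}. {v, u} \<in> F}"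
        using e \<open>e \<subseteq> verts G\<close> by auto
    qed auto
  qed
  finally show ?thesis .
qed

text \<open>Removing \<open>st\<close> leaves \<open>s\<close> with one edge less, so \<open>start_le_wt\<close> applies, and the additional edge of \<open>t\<close> in
  \<open>weight\<close> restores its degree.\<close>

lemma card_cycles_through_edge_le:
  assumes G: "finite_simple_graph G" and e: "{s, t} \<in> edges G"
    and deg2: "\<And>v. v \<in> verts G \<Longrightarrow> 2 \<le> vertex_degree G v"
  shows "real (card {C. subgraph C G \<and> is_cycle C \<and> {s, t} \<in> edges C})
    \<le> (\<Prod>v\<in>verts G. wt (vertex_degree G v))"
proof -
  define V where "V = verts G"
  define F where "F = edges G - {{s, t}}"
  have V: "finite V" "finite (edges G)"
    using G finite_subset[of "edges G" "Pow (verts G)"] by (auto simp: finite_simple_graph_def V_def)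
  have st: "s \<in> V" "t \<in> V" "s \<noteq> t"
    using G e by (auto simp: finite_simple_graph_def V_def)
  have d: "deg (adjacency F) V v + (if v \<in> {s, t} then 1 else 0) = vertex_degree G v" if "v \<in> V" for v
  proof -
    have "{e \<in> edges G. v \<in> e} = (if v \<in> {s, t} then insert {s, t} {e \<in> F. v \<in> e} else {e \<in> F. v \<in> e})"
      using e by (auto simp: F_def)
    moreover have "{s, t} \<notin> F" by (simp add: F_def)
    moreover have "finite {e \<in> F. v \<in> e}" using V by (simp add: F_def)
    ultimately have "vertex_degree G v = card {e \<in> F. v \<in> e} + (if v \<in> {s, t} then 1 else 0)"
      unfolding vertex_degree_def by (simp only:) simp
    then show ?thesis using deg_adjacency[OF G _ that[unfolded V_def], of F] by (simp add: F_def V_def)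
  qed
  have "real (card {C. subgraph C G \<and> is_cycle C \<and> {s, t} \<in> edges C}) \<le> real (card (paths F V s t))"
    using card_cycles_through_edge[of G s t] V by (simp add: V_def F_def)
  also have "\<dots> \<le> real (num_paths (card V) (adjacency F) V s t)"
    using card_paths_le[OF V(1), of "card V" F s t] by simp
  also have "\<dots> \<le> weight (adjacency F) V s t"
    using V st by (intro num_paths_le_weight) (auto simp: adjacency_def insert_commute)
  also have "\<dots> = start (deg (adjacency F) V s) * (wt (vertex_degree G t) * (\<Prod>v\<in>V-{s,t}. wt (vertex_degree G v)))"
  proof -
    have "excess (adjacency F) V = 0" by (simp add: excess_def adjacency_def)
    moreover have "(\<Prod>v\<in>V-{s,t}. wt (deg (adjacency F) V v)) = (\<Prod>v\<in>V-{s,t}. wt (vertex_degree G v))"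
    proof (rule prod.cong)
      fix v assume "v \<in> V - {s, t}"
      then show "wt (deg (adjacency F) V v) = wt (vertex_degree G v)" using d[of v] by simp
    qed simp
    ultimately show ?thesis using d[OF st(2)] by (simp add: weight_def)
  qed
  also have "\<dots> \<le> wt (vertex_degree G s) * (wt (vertex_degree G t) * (\<Prod>v\<in>V-{s,t}. wt (vertex_degree G v)))"
  proof (intro mult_right_mono mult_nonneg_nonneg prod_nonneg)
    have "Suc (deg (adjacency F) V s) = vertex_degree G s" using d[OF st(1)] by simp
    then show "start (deg (adjacency F) V s) \<le> wt (vertex_degree G s)"
      using deg2[of s] st start_le_wt[of "deg (adjacency F) V s"] by (simp add: V_def)
  qed (auto intro: less_imp_le)
  also have "\<dots> = (\<Prod>v\<in>V. wt (vertex_degree G v))"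
  proof -
    have "V - {s} - {t} = V - {s, t}" by auto
    then show ?thesis using V st by (simp add: prod.remove[of V s] prod.remove[of "V - {s}" t])
  qed
  finally show ?thesis by (simp add: V_def)
qed

section \<open>Counting all cycles\<close>

text \<open>A cycle has at least one edge, so it is counted when the cycles through each edge are added up.\<close>

lemma num_cycles_le:
  assumes G: "finite_simple_graph G" and deg2: "\<And>v. v \<in> verts G \<Longrightarrow> 2 \<le> vertex_degree G v"
  shows "real (num_cycles G) \<le> real (card (edges G)) * (\<Prod>v\<in>verts G. wt (vertex_degree G v))"
proof -
  let ?C = "\<lambda>e. {C. subgraph C G \<and> is_cycle C \<and> e \<in> edges C}"
  have fin: "finite (verts G)" "finite (edges G)"
    using G finite_subset[of "edges G" "Pow (verts G)"] by (auto simp: finite_simple_graph_def)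
  have "{C. subgraph C G} \<subseteq> Pow (verts G) \<times> Pow (edges G)"
    by (auto simp: subgraph_def verts_def edges_def)
  then have finC: "finite {C. subgraph C G}" using fin by (meson finite_Pow_iff finite_SigmaI finite_subset)
  have "{C. subgraph C G \<and> is_cycle C} \<subseteq> (\<Union>e\<in>edges G. ?C e)"
  proof
    fix C assume C: "C \<in> {C. subgraph C G \<and> is_cycle C}"
    then obtain vs where "3 \<le> length vs" "edges C = {{vs ! i, vs ! (Suc i mod length vs)} | i. i < length vs}"
      by (auto simp: is_cycle_def)
    then have "{vs ! 0, vs ! (Suc 0 mod length vs)} \<in> edges C" by auto
    then show "C \<in> (\<Union>e\<in>edges G. ?C e)" using C by (auto simp: subgraph_def)
  qed
  then have "num_cycles G \<le> card (\<Union>e\<in>edges G. ?C e)"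
    unfolding num_cycles_def
    by (rule card_mono[rotated]) (rule finite_subset[OF _ finC], auto)
  also have "\<dots> \<le> (\<Sum>e\<in>edges G. card (?C e))" by (rule card_UN_le[OF fin(2)])
  finally have "real (num_cycles G) \<le> (\<Sum>e\<in>edges G. real (card (?C e)))"
    by (simp flip: of_nat_sum)
  also have "\<dots> \<le> (\<Sum>e\<in>edges G. \<Prod>v\<in>verts G. wt (vertex_degree G v))"
  proof (rule sum_mono)
    fix e assume e: "e \<in> edges G"
    then obtain s t where "e = {s, t}" using G by (auto simp: finite_simple_graph_def card_2_iff)
    then show "real (card (?C e)) \<le> (\<Prod>v\<in>verts G. wt (vertex_degree G v))"
      using card_cycles_through_edge_le[OF G _ deg2] e by blast
  qed
  finally show ?thesis by simp
qed

lemma sum_vertex_degree: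
  assumes "finite_simple_graph G"
  shows "(\<Sum>v\<in>verts G. vertex_degree G v) = 2 * card (edges G)"
proof -
  have fin: "finite (verts G)" "finite (edges G)"
    using assms finite_subset[of "edges G" "Pow (verts G)"] by (auto simp: finite_simple_graph_def)
  have "(\<Sum>v\<in>verts G. vertex_degree G v) = (\<Sum>v\<in>verts G. \<Sum>e\<in>edges G. if v \<in> e then 1 else 0)"
    using fin by (simp add: vertex_degree_def sum.inter_filter[symmetric])
  also have "\<dots> = (\<Sum>e\<in>edges G. \<Sum>v\<in>verts G. if v \<in> e then 1 else 0)" by (rule sum.swap)
  also have "\<dots> = (\<Sum>e\<in>edges G. 2)"
  proof (rule sum.cong)
    fix e assume "e \<in> edges G"
    then have "card e = 2" "{v \<in> verts G. v \<in> e} = e" using assms by (auto simp: finite_simple_graph_def)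
    then show "(\<Sum>v\<in>verts G. if v \<in> e then 1 else 0) = (2::nat)"
      using fin by (simp add: sum.inter_filter[symmetric])
  qed simp
  finally show ?thesis by simp
qed

text \<open>Concavity of \<open>ln b\<close> on the integers from 2 on.\<close>

lemma ln_wt_tangent:
  assumes "2 \<le> i" "2 \<le> k"
  shows "ln (wt i) \<le> ln (wt k) + (real i - real k) * step k"
proof (cases "k \<le> i")
  case True
  then show ?thesis
  proof (induction i rule: nat_induct_at_least)
    case (Suc i)
    have "step i \<le> step k" using step_antimono[of k i] Suc.hyps assms by simp
    moreover have "ln (wt (Suc i)) = ln (wt i) + step i" by (simp add: step_def)
    ultimately show ?case using Suc.IH by (simp add: algebra_simps)
  qed simp
next
  case False
  then have "i \<le> k" by simp
  then show ?thesis using assms(1)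
  proof (induction i rule: inc_induct)
    case (step i)
    have "step k \<le> step i" using step_antimono[of i k] step by simp
    moreover have "ln (wt (Suc i)) = ln (wt i) + step i" by (simp add: step_def)
    ultimately show ?case using step by (simp add: algebra_simps)
  qed simp
qed

text \<open>Thus \<open>d / 2 * ln (gamma d)\<close> is the value at \<open>d\<close> of the chord of \<open>ln b\<close> over \<open>[k, k + 1]\<close>, for integral
  \<open>d\<close> as well.\<close>

lemma gamma_eq:
  assumes d: "2 \<le> d" and k: "k = nat \<lfloor>d\<rfloor>"
  shows "gamma d = exp (2 / d * (ln (wt k) + (d - real k) * step k))"
proof -
  have k2: "2 \<le> k" using d by (simp add: k le_nat_iff le_floor_iff)
  have rk: "real_of_int \<lfloor>d\<rfloor> = real k" using d by (simp add: k)
  have b: "b_val i = wt i" if "2 \<le> i" for i using that by (simp add: wt_def)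
  show ?thesis
  proof (cases "d \<in> \<int>")
    case True
    then have "d = real k" using rk by (metis Ints_cases floor_of_int)
    then show ?thesis using True k2 b[of k] by (simp add: gamma_def powr_def k[symmetric] flip: k)
  next
    case False
    have "d \<noteq> real_of_int \<lfloor>d\<rfloor>" using False by (metis Ints_of_int)
    then have "\<lceil>d\<rceil> = \<lfloor>d\<rfloor> + 1" by (simp add: ceiling_altdef)
    then have c: "nat \<lceil>d\<rceil> = Suc k" "real_of_int \<lceil>d\<rceil> = real k + 1"
      using d rk by (auto simp: k nat_add_distrib)
    have "gamma d = wt k powr (2 * (real k + 1 - d) / d) * wt (Suc k) powr (2 * (d - real k) / d)"
      using False k2 by (simp add: gamma_def c rk b flip: k)
    also have "\<dots> = exp (2 * (real k + 1 - d) / d * ln (wt k) + 2 * (d - real k) / d * ln (wt (Suc k)))"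
      by (simp add: powr_def exp_add)
    also have "2 * (real k + 1 - d) / d * ln (wt k) + 2 * (d - real k) / d * ln (wt (Suc k)) =
        2 / d * (ln (wt k) + (d - real k) * step k)"
      using d by (simp add: step_def field_simps)
    finally show ?thesis .
  qed
qed

theorem corollary8:
  fixes d :: real and G :: "'a graph" and m :: nat
  assumes "2 \<le> d"
    and "finite_simple_graph G"
    and "card (edges G) = m"
    and "2 \<le> min_degree G"
    and "average_degree G = d"
  shows "real (num_cycles G) \<le> real m * gamma d ^ m"
proof -
  define n where "n = card (verts G)"
  define k where "k = nat \<lfloor>d\<rfloor>"
  have fin: "finite (verts G)" using assms(2) by (simp add: finite_simple_graph_def)
  have d: "2 * real m / real n = d" using assms(3,5) by (simp add: average_degree_def n_def)
  then have n: "n \<noteq> 0" using assms(1) by (cases "n = 0") auto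
  have m: "real m * 2 = real n * d" using d n by (simp add: field_simps)
  have k2: "2 \<le> k" using assms(1) by (simp add: k_def le_nat_iff le_floor_iff)
  have deg2: "2 \<le> vertex_degree G v" if "v \<in> verts G" for v
    using assms(4) fin that unfolding min_degree_def
    by (meson Min_le finite_imageI image_eqI order_trans)
  have "(\<Prod>v\<in>verts G. wt (vertex_degree G v)) = exp (\<Sum>v\<in>verts G. ln (wt (vertex_degree G v)))"
    using fin by (simp add: exp_sum)
  also have "\<dots> \<le> exp (\<Sum>v\<in>verts G. ln (wt k) + (real (vertex_degree G v) - real k) * step k)"
    using deg2 k2 by (auto intro!: sum_mono ln_wt_tangent)
  also have "(\<Sum>v\<in>verts G. ln (wt k) + (real (vertex_degree G v) - real k) * step k) =
      real n * ln (wt k) + (real (\<Sum>v\<in>verts G. vertex_degree G v) - real n * real k) * step k"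
    by (simp add: sum.distrib n_def sum_subtractf flip: sum_distrib_right)
  also have "\<dots> = real n * (ln (wt k) + (d - real k) * step k)"
    using m assms(3) by (simp add: sum_vertex_degree[OF assms(2)] algebra_simps)
  also have "\<dots> = real m * (2 / d * (ln (wt k) + (d - real k) * step k))"
  proof -
    have "real n = real m * (2 / d)" using m assms(1) by (simp add: field_simps)
    then show ?thesis by (simp only: mult.assoc)
  qed
  also have "exp \<dots> = gamma d ^ m"
    by (simp only: exp_of_nat_mult gamma_eq[OF assms(1) k_def])
  finally have "real m * (\<Prod>v\<in>verts G. wt (vertex_degree G v)) \<le> real m * gamma d ^ m"
    by (rule mult_left_mono) simp
  then show ?thesis using num_cycles_le[OF assms(2) deg2] assms(3) by simp
qed

end
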